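(* Let $\mu$ be a doubling measure in $\mathbb{R}^n$ with doubling constant $c_\mu$ and doubling dimension $n_\mu$. Let $\phi$ be a quasi-submultiplicative Young function with associated quasi-submultiplicative constant $c>0$. Assume further that $\phi$ is differentiable for $t>1$ and let $[\phi]_1$ and $[\phi]_2$ be the best constants satisfying $[\phi]_1\phi(t)\le t\phi'(t)\le[\phi]_2\phi(t)$ for all $t>1$. If $f\in\mathrm{BMO}(d\mu)$ then \[ \|f-f_{Q,\mu}\|_{\phi(L)\left(Q,\frac{d\mu}{\mu(Q)}\right)}\le c_\mu2^{n_\mu}\,\phi\left[c\left(1+\frac1{[\phi]_1}\right)\right]\left([\phi]_2+1\right)\|f\|_{\mathrm{BMO}(d\mu)} \] for every cube $Q$ in $\mathbb{R}^n$.
   Context: A (nontrivial, Borel, locally finite) measure $\mu$ on $\mathbb{R}^n$ is doubling with doubling constant $c_\mu\ge1$ and doubling dimension $n_\mu>0$ if $\mu(\tilde Q)\le c_\mu(\ell(\tilde Q)/\ell(Q))^{n_\mu}\mu(Q)$ for all cubes $Q\subset\tilde Q$, where $\ell$ is side length. Put $f_{Q,\mu}=\frac1{\mu(Q)}\int_Q f\,d\mu$ and $\|f\|_{\mathrm{BMO}(d\mu)}=\sup_{Q}\frac1{\mu(Q)}\int_Q|f-f_{Q,\mu}|\,d\mu$ over all cubes; $\mathrm{BMO}(d\mu)$ is the set of $f\in L^1_{\mathrm{loc}}(d\mu)$ for which this is finite. A Young function is a convex $\phi:[0,\infty)\to[0,\infty)$ with $\phi(0)=0$, $\phi(1)=1$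 and $\lim_{t\to\infty}\phi(t)=\infty$. It is quasi-submultiplicative with associated constant $c>0$ if $\phi(t_1t_2)\le c\,\phi(t_1)\phi(t_2)$ for all $t_1,t_2\ge0$. The local Orlicz average is \[ \|f\|_{\phi(L)\left(Q,\frac{d\mu}{\mu(Q)}\right)}=\inf\left\{\lambda>0:\frac1{\mu(Q)}\int_Q\phi\left(\frac{|f(x)|}{\lambda}\right)d\mu(x)\le1\right\}. \] *)

theory Defs
  imports "HOL-Analysis.Analysis"
begin

text \<open>Cubes are closed, nondegenerate, with sides parallel to the coordinate axes; \<open>cube a l\<close> has
  lower corner \<open>a\<close> and side length \<open>l\<close>. It is used only with \<open>l > 0\<close>.\<close>

definition cube :: "real ^ 'n \<Rightarrow> real \<Rightarrow> (real ^ 'n) set" where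
  "cube a l = cbox a (\<chi> i. a $ i + l)"

definition doubling_measure :: "(real ^ 'n) measure \<Rightarrow> real \<Rightarrow> real \<Rightarrow> bool" where
  "doubling_measure \<mu> c\<^sub>\<mu> n\<^sub>\<mu> \<longleftrightarrow>
     sets \<mu> = sets borel \<and>
     emeasure \<mu> UNIV \<noteq> 0 \<and>
     (\<forall>x. \<exists>U. open U \<and> x \<in> U \<and> emeasure \<mu> U < \<infinity>) \<and>
     c\<^sub>\<mu> \<ge> 1 \<and> n\<^sub>\<mu> > 0 \<and>
     (\<forall>a l b m. l > 0 \<longrightarrow> m > 0 \<longrightarrow> cube a l \<subseteq> cube b m \<longrightarrow>
        emeasure \<mu> (cube b m) \<le> ennreal (c\<^sub>\<mu> * (m / l) powr n\<^sub>\<mu>) * emeasure \<mu> (cube a l))"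

definition average :: "(real ^ 'n) measure \<Rightarrow> (real ^ 'n) set \<Rightarrow> (real ^ 'n \<Rightarrow> real) \<Rightarrow> real" where
  "average \<mu> Q f = (LINT x:Q|\<mu>. f x) / measure \<mu> Q"

definition locally_integrable :: "(real ^ 'n) measure \<Rightarrow> (real ^ 'n \<Rightarrow> real) \<Rightarrow> bool" where
  "locally_integrable \<mu> f \<longleftrightarrow> (\<forall>K. compact K \<longrightarrow> set_integrable \<mu> K f)"

definition bmo_norm :: "(real ^ 'n) measure \<Rightarrow> (real ^ 'n \<Rightarrow> real) \<Rightarrow> ennreal" where
  "bmo_norm \<mu> f =
     (SUP Q \<in> {cube a l | a l. l > 0}.
        (\<integral>\<^sup>+x\<in>Q. ennreal \<bar>f x - average \<mu> Q f\<bar> \<partial>\<mu>) / emeasure \<mu> Q)"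

definition BMO :: "(real ^ 'n) measure \<Rightarrow> (real ^ 'n \<Rightarrow> real) set" where
  "BMO \<mu> = {f. locally_integrable \<mu> f \<and> bmo_norm \<mu> f < \<infinity>}"

text \<open>Young functions are total functions on the reals here, but only their values on
  \<open>[0, \<infinity>)\<close> matter.\<close>

definition young_function :: "(real \<Rightarrow> real) \<Rightarrow> bool" where
  "young_function \<phi> \<longleftrightarrow>
     convex_on {0..} \<phi> \<and> (\<forall>t\<ge>0. \<phi> t \<ge> 0) \<and> \<phi> 0 = 0 \<and> \<phi> 1 = 1 \<and> filterlim \<phi> at_top at_top"

definition quasi_submultiplicative :: "(real \<Rightarrow> real) \<Rightarrow> real \<Rightarrow> bool" where
  "quasi_submultiplicative \<phi> c \<longleftrightarrow>
     c > 0 \<and> (\<forall>t\<^sub>1\<ge>0. \<forall>t\<^sub>2\<ge>0. \<phi> (t\<^sub>1 * t\<^sub>2) \<le> c * \<phi> t\<^sub>1 * \<phi> t\<^sub>2)"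

text \<open>The infimum is taken in \<^typ>\<open>ennreal\<close>, so it is \<open>\<infinity>\<close> if no \<open>\<lambda>\<close> is admissible.\<close>

definition orlicz_average ::
  "(real \<Rightarrow> real) \<Rightarrow> (real ^ 'n) measure \<Rightarrow> (real ^ 'n) set \<Rightarrow> (real ^ 'n \<Rightarrow> real) \<Rightarrow> ennreal" where
  "orlicz_average \<phi> \<mu> Q f =
     Inf {ennreal r | r. r > 0 \<and>
        (\<integral>\<^sup>+x\<in>Q. ennreal (\<phi> (\<bar>f x\<bar> / r)) \<partial>\<mu>) / emeasure \<mu> Q \<le> 1}"

text \<open>The best constants \<open>[\<phi>]\<^sub>1\<close> and \<open>[\<phi>]\<^sub>2\<close>. For a quasi-submultiplicative Young function that is
  differentiable on \<open>(1, \<infinity>)\<close> they exist and are attained, see the two lemmas below.\<close>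

definition lower_index :: "(real \<Rightarrow> real) \<Rightarrow> real" where
  "lower_index \<phi> = Sup {p. \<forall>t>1. p * \<phi> t \<le> t * deriv \<phi> t}"

definition upper_index :: "(real \<Rightarrow> real) \<Rightarrow> real" where
  "upper_index \<phi> = Inf {p. \<forall>t>1. t * deriv \<phi> t \<le> p * \<phi> t}"

lemma young_function_tangent:
  assumes "young_function \<phi>" "\<phi> differentiable (at t)" "t > 1" "s \<ge> 0"
  shows "\<phi> s - \<phi> t \<ge> deriv \<phi> t * (s - t)"
proof (rule convex_on_imp_above_tangent)
  show "convex_on {0..} \<phi>"
    using assms(1) by (simp add: young_function_def)
  have "(\<phi> has_field_derivative deriv \<phi> t) (at t)"
    using assms(2) DERIV_imp_deriv real_differentiable_def by blast
  then show "(\<phi> has_field_derivative deriv \<phi> t) (at t within {0..})"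
    by (rule has_field_derivative_at_within)
qed (use assms in auto)

lemma young_function_ge:
  assumes "young_function \<phi>" "t > 1"
  shows "\<phi> t \<ge> t"
proof -
  have "convex_on {0..} \<phi>" and eq: "\<phi> 0 = 0" "\<phi> 1 = 1"
    using assms(1) by (auto simp: young_function_def)
  then have "\<phi> ((1 - 1 / t) *\<^sub>R 0 + (1 / t) *\<^sub>R t) \<le> (1 - 1 / t) * \<phi> 0 + (1 / t) * \<phi> t"
    using assms(2) by (intro convex_onD) auto
  with eq assms(2) show ?thesis
    by (simp add: field_simps)
qed

lemma lower_index_best:
  assumes "young_function \<phi>" "\<And>t. t > 1 \<Longrightarrow> \<phi> differentiable (at t)"
  shows "lower_index \<phi> \<ge> 1"
    and "\<And>t. t > 1 \<Longrightarrow> lower_index \<phi> * \<phi> t \<le> t * deriv \<phi> t"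
    and "\<And>p. (\<And>t. t > 1 \<Longrightarrow> p * \<phi> t \<le> t * deriv \<phi> t) \<Longrightarrow> p \<le> lower_index \<phi>"
proof -
  let ?A = "{p. \<forall>t>1. p * \<phi> t \<le> t * deriv \<phi> t}"
  have pos: "\<phi> t > 0" if "t > 1" for t
    using young_function_ge[OF assms(1) that] that by simp
  have ub: "p \<le> t * deriv \<phi> t / \<phi> t" if "p \<in> ?A" "t > 1" for p t
    using that pos[of t] by (simp add: field_simps)
  then have bdd: "bdd_above ?A"
    by (intro bdd_aboveI[of _ "2 * deriv \<phi> 2 / \<phi> 2"]) auto
  have "\<phi> 0 = 0"
    using assms(1) by (simp add: young_function_def)
  then have one: "1 \<in> ?A"
    using young_function_tangent[OF assms(1) assms(2), of _ 0] by (auto simp: mult.commute)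
  then show "lower_index \<phi> \<ge> 1"
    unfolding lower_index_def using bdd by (rule cSup_upper)
  show "p \<le> lower_index \<phi>" if "\<And>t. t > 1 \<Longrightarrow> p * \<phi> t \<le> t * deriv \<phi> t" for p
    unfolding lower_index_def using that bdd by (intro cSup_upper) auto
  show "lower_index \<phi> * \<phi> t \<le> t * deriv \<phi> t" if "t > 1" for t
  proof -
    have "lower_index \<phi> \<le> t * deriv \<phi> t / \<phi> t"
      unfolding lower_index_def using one ub[OF _ that] by (intro cSup_least) blast+
    then show ?thesis
      using pos[OF that] by (simp add: field_simps)
  qed
qed

lemma upper_index_best:
  assumes "young_function \<phi>" "quasi_submultiplicative \<phi> c"
    and "\<And>t. t > 1 \<Longrightarrow> \<phi> differentiable (at t)"
  shows "\<And>t. t > 1 \<Longrightarrow> t * deriv \<phi> t \<le> upper_index \<phi> * \<phi> t"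
    and "\<And>p. (\<And>t. t > 1 \<Longrightarrow> t * deriv \<phi> t \<le> p * \<phi> t) \<Longrightarrow> upper_index \<phi> \<le> p"
proof -
  let ?B = "{p. \<forall>t>1. t * deriv \<phi> t \<le> p * \<phi> t}"
  have pos: "\<phi> t > 0" if "t > 1" for t
    using young_function_ge[OF assms(1) that] that by simp
  have lb: "t * deriv \<phi> t / \<phi> t \<le> p" if "p \<in> ?B" "t > 1" for p t
    using that pos[of t] by (simp add: field_simps)
  then have bdd: "bdd_below ?B"
    by (intro bdd_belowI[of _ "2 * deriv \<phi> 2 / \<phi> 2"]) auto
  have mem: "c * \<phi> 2 \<in> ?B"
  proof (intro CollectI allI impI)
    fix t :: real
    assume t: "t > 1"
    have "t * deriv \<phi> t \<le> \<phi> (2 * t) - \<phi> t"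
      using young_function_tangent[OF assms(1) assms(3)[OF t] t, of "2 * t"] t
      by (simp add: mult.commute)
    also have "\<dots> \<le> \<phi> (2 * t)"
      using pos[OF t] by simp
    also have "\<dots> \<le> c * \<phi> 2 * \<phi> t"
      using assms(2) t by (simp add: quasi_submultiplicative_def)
    finally show "t * deriv \<phi> t \<le> c * \<phi> 2 * \<phi> t" .
  qed
  show "upper_index \<phi> \<le> p" if "\<And>t. t > 1 \<Longrightarrow> t * deriv \<phi> t \<le> p * \<phi> t" for p
    unfolding upper_index_def using that bdd by (intro cInf_lower) auto
  show "t * deriv \<phi> t \<le> upper_index \<phi> * \<phi> t" if "t > 1" for t
  proof -
    have "t * deriv \<phi> t / \<phi> t \<le> upper_index \<phi>"
      unfolding upper_index_def using mem lb[OF _ that] by (intro cInf_greatest) blast+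
    then show ?thesis
      using pos[OF that] by (simp add: field_simps)
  qed
qed

end

theory Submission
  imports Defs "HOL-Real_Asymp.Real_Asymp"
begin

text \<open>The proof is a self-improvement argument. Write \<open>D = c\<^sub>\<mu> 2\<^sup>n\<close> with \<open>n = n\<^sub>\<mu>\<close> for the constant that
  compares a dyadic cube with its parent, and let \<open>b\<close> bound the mean oscillations of \<open>f\<close>. Suppose that on
  every cube the Orlicz average of the deviation is at most \<open>X\<close>. Cut a cube \<open>Q\<close> with the
  Calderon-Zygmund decomposition of \<open>\<bar>f - f\<^sub>Q\<bar>\<close> at height \<open>L b\<close>, where \<open>L = c \<phi>(s)\<close> for some
  \<open>s > 1\<close> (lemma \<open>calderon_zygmund\<close>). Outside the selected cubes the deviation is at most \<open>L b\<close>.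
  On a selected cube \<open>R\<close> it is the jump \<open>f\<^sub>R - f\<^sub>Q\<close>, which is at most \<open>D L b\<close>, plus the deviation
  from \<open>f\<^sub>R\<close>, to which the assumption applies. The selected cubes have total measure at most
  \<open>\<mu>(Q) / L\<close>, and this smallness pays for the factor \<open>c \<phi>(s)\<close> lost by dividing the scale \<open>X\<close> by
  \<open>s\<close>. Hence \<open>X\<close> may be replaced by \<open>D L b + X / s\<close> (lemma \<open>oscillation_step\<close>).

  Iterating, \<open>X\<close> decreases to the fixed point \<open>D c \<phi>(s) b s / (s - 1)\<close>, once some finite \<open>X\<close> is
  available (lemma \<open>oscillation_bounded\<close>). Bounded functions have one, and truncation
  does not increase mean oscillations (lemma \<open>oscillation_contraction_le\<close>), so the bound passes to \<open>f\<close> by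
  Fatou's lemma. The choice \<open>s = 1 + 1 / [\<phi>]\<^sub>1\<close> gives \<open>D c \<phi>(1 + 1 / [\<phi>]\<^sub>1) ([\<phi>]\<^sub>1 + 1) b\<close>, and the
  stated constant dominates this because \<open>c \<ge> 1\<close>, so that convexity gives
  \<open>c \<phi>(s) \<le> \<phi>(c s)\<close>, and because \<open>[\<phi>]\<^sub>1 \<le> [\<phi>]\<^sub>2\<close>.

  Doubling, mean oscillations and the conclusion all refer to closed cubes, whose dyadic children
  overlap in faces. The decomposition therefore works with half-open cubes, and monotone limits of
  cubes translate the hypotheses and the conclusion.\<close>

section \<open>Half-open cubes and the doubling property\<close>

text \<open>Half-open cubes are partitioned by their dyadic subcubes, whatever mass \<open>\<mu>\<close> gives to
  faces.\<close>

definition hcube :: "real ^ 'n \<Rightarrow> real \<Rightarrow> (real ^ 'n) set" where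
  "hcube a l = {x. \<forall>i. a $ i \<le> x $ i \<and> x $ i < a $ i + l}"

lemma mem_cube: "x \<in> cube a l \<longleftrightarrow> (\<forall>i. a $ i \<le> x $ i \<and> x $ i \<le> a $ i + l)"
  by (auto simp: cube_def mem_box_cart)

lemma mem_hcube: "x \<in> hcube a l \<longleftrightarrow> (\<forall>i. a $ i \<le> x $ i \<and> x $ i < a $ i + l)"
  by (simp add: hcube_def)

lemma cube_subset_hcube: "m < l \<Longrightarrow> cube a m \<subseteq> hcube a l"
  unfolding subset_iff mem_cube mem_hcube by (meson add_strict_left_mono order_le_less_trans)

lemma hcube_subset_cube: "hcube a l \<subseteq> cube a l"
  unfolding subset_iff mem_cube mem_hcube by (blast intro: less_imp_le)

lemma compact_cube: "compact (cube a l)"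
  by (simp add: cube_def compact_cbox)

lemma borel_cube [measurable]: "cube a l \<in> sets borel"
  by (simp add: cube_def)

lemma borel_hcube [measurable]: "hcube a l \<in> sets borel"
proof -
  have "hcube a l = (\<Inter>i. {x. a $ i \<le> x $ i} \<inter> {x. x $ i < a $ i + l})"
    by (auto simp: mem_hcube)
  also have "\<dots> \<in> sets borel"
    by (intro sets.countable_INT'' borel_closed borel_open sets.Int closed_Collect_le
        open_Collect_less continuous_intros) auto
  finally show ?thesis .
qed

locale doubling =
  fixes \<mu> :: "(real ^ 'n) measure" and c\<^sub>\<mu> n\<^sub>\<mu> :: real
  assumes doubling: "doubling_measure \<mu> c\<^sub>\<mu> n\<^sub>\<mu>"
begin

lemma sets_mu [measurable_cong, simp]: "sets \<mu> = sets borel"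
  using doubling by (simp add: doubling_measure_def)

lemma space_mu [simp]: "space \<mu> = UNIV"
  using sets_eq_imp_space_eq[OF sets_mu] by simp

lemma emeasure_compact_finite:
  assumes "compact K"
  shows "emeasure \<mu> K < \<infinity>"
proof -
  have "\<forall>x. \<exists>U. open U \<and> x \<in> U \<and> emeasure \<mu> U < \<infinity>"
    using doubling by (simp add: doubling_measure_def)
  then obtain U where U: "\<And>x. open (U x)" "\<And>x. x \<in> U x" "\<And>x. emeasure \<mu> (U x) < \<infinity>"
    by metis
  have "K \<subseteq> (\<Union>x\<in>UNIV. U x)" using U(2) by blast
  then obtain C where C: "finite C" "K \<subseteq> (\<Union>x\<in>C. U x)"
    by (rule compactE_image[OF assms U(1)])
  have "emeasure \<mu> K \<le> emeasure \<mu> (\<Union>x\<in>C. U x)"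
    using C U(1) by (intro emeasure_mono) auto
  also have "\<dots> \<le> (\<Sum>x\<in>C. emeasure \<mu> (U x))"
    using C U(1) by (intro emeasure_subadditive_finite) auto
  also have "\<dots> < \<infinity>"
    using U(3) C(1) by simp
  finally show ?thesis .
qed

lemma doubling_cube:
  assumes "l > 0" "m > 0" "cube a l \<subseteq> cube b m"
  shows "emeasure \<mu> (cube b m) \<le> ennreal (c\<^sub>\<mu> * (m / l) powr n\<^sub>\<mu>) * emeasure \<mu> (cube a l)"
  using doubling assms by (auto simp: doubling_measure_def)

lemma constants: "c\<^sub>\<mu> \<ge> 1" "n\<^sub>\<mu> > 0"
  using doubling by (auto simp: doubling_measure_def)

text \<open>Doubling propagates positivity from a large cube to any cube inside it, and large cubes
  exhaust the space.\<close>

lemma emeasure_cube_pos: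
  assumes "l > 0"
  shows "emeasure \<mu> (cube a l) > 0"
proof (rule ccontr)
  assume "\<not> emeasure \<mu> (cube a l) > 0"
  then have z: "emeasure \<mu> (cube a l) = 0" by (simp add: zero_less_iff_neq_zero)
  define b where "b k = (\<chi> i. a $ i - real k)" for k :: nat
  have "emeasure \<mu> (cube (b k) (l + 2 * real k)) = 0" for k
  proof -
    have "cube a l \<subseteq> cube (b k) (l + 2 * real k)"
    proof
      fix x assume x: "x \<in> cube a l"
      show "x \<in> cube (b k) (l + 2 * real k)"
        unfolding mem_cube
      proof
        fix i
        have "a $ i \<le> x $ i \<and> x $ i \<le> a $ i + l" using x by (simp add: mem_cube)
        then show "b k $ i \<le> x $ i \<and> x $ i \<le> b k $ i + (l + 2 * real k)" by (simp add: b_def)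
      qed
    qed
    then show ?thesis
      using doubling_cube[of l "l + 2 * real k" a "b k"] assms z by simp
  qed
  then have "(\<Union>k. cube (b k) (l + 2 * real k)) \<in> null_sets \<mu>"
    by (intro null_sets_UN) (auto intro: null_setsI)
  moreover have "(\<Union>k. cube (b k) (l + 2 * real k)) = UNIV"
  proof -
    have "\<exists>k. x \<in> cube (b k) (l + 2 * real k)" for x
    proof -
      obtain k :: nat where k: "norm (x - a) \<le> real k"
        using real_arch_simple by blast
      have "\<bar>x $ i - a $ i\<bar> \<le> real k" for i
        using component_le_norm_cart[of "x - a" i] k by simp
      then have "a $ i - real k \<le> x $ i \<and> x $ i \<le> a $ i - real k + (l + 2 * real k)" for i
        using assms by (smt (verit))
      then show ?thesis
        by (intro exI[of _ k]) (simp add: mem_cube b_def)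
    qed
    then show ?thesis by auto
  qed
  ultimately have "emeasure \<mu> UNIV = 0" by auto
  then show False using doubling by (simp add: doubling_measure_def)
qed

lemma emeasure_hcube_finite: "emeasure \<mu> (hcube a l) < \<infinity>"
  by (rule le_less_trans[OF emeasure_mono[OF hcube_subset_cube] emeasure_compact_finite[OF compact_cube]])
    simp

lemma emeasure_hcube_pos:
  assumes "l > 0"
  shows "emeasure \<mu> (hcube a l) > 0"
proof -
  have "0 < emeasure \<mu> (cube a (l / 2))"
    using assms by (intro emeasure_cube_pos) simp
  also have "\<dots> \<le> emeasure \<mu> (hcube a l)"
    using assms by (intro emeasure_mono cube_subset_hcube) auto
  finally show ?thesis .
qed

lemma emeasure_hcube_eq: "emeasure \<mu> (hcube a l) = ennreal (measure \<mu> (hcube a l))"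
  using emeasure_hcube_finite[of a l] by (simp add: emeasure_eq_ennreal_measure)

lemma measure_hcube_pos: "l > 0 \<Longrightarrow> measure \<mu> (hcube a l) > 0"
  using emeasure_hcube_pos[of l a] by (simp add: emeasure_hcube_eq)

text \<open>Closed cubes of side \<open>t l\<close> with \<open>t < 1\<close> fit inside the half-open cube of side \<open>l\<close>; the
  doubling constant survives the limit \<open>t \<rightarrow> 1\<close>.\<close>

lemma doubling_hcube:
  assumes "l > 0" "hcube a l \<subseteq> hcube b (2 * l)"
  shows "emeasure \<mu> (hcube b (2 * l)) \<le> ennreal (c\<^sub>\<mu> * 2 powr n\<^sub>\<mu>) * emeasure \<mu> (hcube a l)"
proof -
  let ?M = "measure \<mu>"
  have *: "?M (hcube b (2 * l)) \<le> c\<^sub>\<mu> * (2 / t) powr n\<^sub>\<mu> * ?M (hcube a l)" if t: "0 < t" "t < 1" for t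
  proof -
    have sub: "cube a (t * l) \<subseteq> hcube a l"
      using t assms by (intro cube_subset_hcube) simp
    have "emeasure \<mu> (hcube b (2 * l)) \<le> emeasure \<mu> (cube b (2 * l))"
      by (intro emeasure_mono hcube_subset_cube) simp
    also have "\<dots> \<le> ennreal (c\<^sub>\<mu> * (2 * l / (t * l)) powr n\<^sub>\<mu>) * emeasure \<mu> (cube a (t * l))"
      using assms t sub hcube_subset_cube[of b "2 * l"] by (intro doubling_cube) auto
    also have "\<dots> \<le> ennreal (c\<^sub>\<mu> * (2 * l / (t * l)) powr n\<^sub>\<mu>) * emeasure \<mu> (hcube a l)"
      by (intro mult_left_mono emeasure_mono sub) auto
    also have "2 * l / (t * l) = 2 / t" using assms by simp
    finally show ?thesis
      using constants by (simp add: emeasure_hcube_eq flip: ennreal_mult)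
  qed
  have "((\<lambda>t. c\<^sub>\<mu> * (2 / t) powr n\<^sub>\<mu> * ?M (hcube a l)) \<longlongrightarrow> c\<^sub>\<mu> * (2 / 1) powr n\<^sub>\<mu> * ?M (hcube a l)) (at_left 1)"
    by (intro tendsto_intros) auto
  moreover have "eventually (\<lambda>t. ?M (hcube b (2 * l)) \<le> c\<^sub>\<mu> * (2 / t) powr n\<^sub>\<mu> * ?M (hcube a l)) (at_left 1)"
    unfolding eventually_at_left_field by (intro exI[of _ 0]) (auto intro: *)
  ultimately have "?M (hcube b (2 * l)) \<le> c\<^sub>\<mu> * (2 / 1) powr n\<^sub>\<mu> * ?M (hcube a l)"
    by (intro tendsto_lowerbound) auto
  then show ?thesis
    using constants by (simp add: emeasure_hcube_eq flip: ennreal_mult)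
qed

end

section \<open>Dyadic subcubes\<close>

text \<open>The cells of the \<open>k\<close>-th dyadic generation of the half-open cube with corner \<open>a\<close> and side
  \<open>l\<close>. Addressing a cell by one of its points makes each generation an equivalence relation, so
  that the partition property needs no index sets.\<close>

definition cell :: "real ^ 'n \<Rightarrow> real \<Rightarrow> nat \<Rightarrow> real ^ 'n \<Rightarrow> (real ^ 'n) set" where
  "cell a l k x = {y. \<forall>i. \<lfloor>(y $ i - a $ i) / (l / 2 ^ k)\<rfloor> = \<lfloor>(x $ i - a $ i) / (l / 2 ^ k)\<rfloor>}"

lemma cell_refl: "x \<in> cell a l k x"
  by (simp add: cell_def)

lemma cell_eq: "y \<in> cell a l k x \<Longrightarrow> cell a l k y = cell a l k x"
  by (auto simp: cell_def)

lemma cell_Suc_subset: "cell a l (Suc k) x \<subseteq> cell a l k x"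
proof -
  have "\<lfloor>(u - v) / (l / 2 ^ k)\<rfloor> = \<lfloor>(u - v) / (l / 2 ^ Suc k)\<rfloor> div 2" for u v :: real
  proof -
    have "(u - v) / (l / 2 ^ Suc k) / of_int 2 = (u - v) / (l / 2 ^ k)"
      by simp
    then show ?thesis
      using floor_divide_real_eq_div[of 2 "(u - v) / (l / 2 ^ Suc k)"] by simp
  qed
  then show ?thesis
    by (auto simp: cell_def)
qed

lemma cell_antimono: "j \<le> k \<Longrightarrow> cell a l k x \<subseteq> cell a l j x"
  by (induction k rule: dec_induct) (use cell_Suc_subset in blast)+

lemma cell_0:
  assumes "l > 0" "x \<in> hcube a l"
  shows "cell a l 0 x = hcube a l"
proof -
  have "\<lfloor>(u - v) / l\<rfloor> = 0 \<longleftrightarrow> v \<le> u \<and> u < v + l" for u v :: real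
    using assms(1) by (simp add: floor_eq_iff field_simps)
  note * = this
  have "\<lfloor>(x $ i - a $ i) / l\<rfloor> = 0" for i
    using assms(2) unfolding * mem_hcube by blast
  then have "cell a l 0 x = {y. \<forall>i. \<lfloor>(y $ i - a $ i) / l\<rfloor> = 0}"
    unfolding cell_def by simp
  then show ?thesis
    unfolding * hcube_def .
qed

lemma cell_is_hcube:
  assumes "l > 0"
  obtains b where "cell a l k x = hcube b (l / 2 ^ k)"
proof
  let ?m = "l / 2 ^ k"
  have m: "?m > 0" using assms by simp
  have "\<lfloor>(u - v) / ?m\<rfloor> = z \<longleftrightarrow> v + of_int z * ?m \<le> u \<and> u < v + of_int z * ?m + ?m" for u v z
  proof -
    have "\<lfloor>(u - v) / ?m\<rfloor> = z \<longleftrightarrow> of_int z \<le> (u - v) / ?m \<and> (u - v) / ?m < of_int z + 1"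
      by (simp add: floor_eq_iff)
    also have "\<dots> \<longleftrightarrow> of_int z * ?m \<le> u - v \<and> u - v < (of_int z + 1) * ?m"
      by (simp only: pos_le_divide_eq[OF m] pos_divide_less_eq[OF m])
    also have "\<dots> \<longleftrightarrow> v + of_int z * ?m \<le> u \<and> u < v + of_int z * ?m + ?m"
      unfolding distrib_right by linarith
    finally show ?thesis .
  qed
  then show "cell a l k x = hcube (\<chi> i. a $ i + of_int \<lfloor>(x $ i - a $ i) / ?m\<rfloor> * ?m) ?m"
    by (auto simp: cell_def mem_hcube)
qed

lemma countable_cells:
  fixes a :: "real ^ 'n"
  shows "countable (range (cell a l k))"
proof -
  let ?v = "\<lambda>x :: real ^ 'n. \<chi> i. \<lfloor>(x $ i - a $ i) / (l / 2 ^ k)\<rfloor>"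
  let ?D = "\<lambda>z :: int ^ 'n. {y. ?v y = z}"
  have "cell a l k x = ?D (?v x)" for x
    by (auto simp: cell_def vec_eq_iff)
  then have "range (cell a l k) \<subseteq> range ?D" by auto
  then show ?thesis
    by (rule countable_subset) (rule countable_image, simp)
qed

lemma cell_in_open:
  assumes "l > 0" "open U" "x \<in> U"
  shows "\<exists>k. cell a l k (x :: real ^ 'n) \<subseteq> U"
proof -
  obtain e where e: "e > 0" "ball x e \<subseteq> U"
    using assms(2,3) openE by blast
  let ?N = "real CARD('n)"
  obtain k where k: "?N * l / e < 2 ^ k"
    using real_arch_pow[of 2] by auto
  then have k: "?N * (l / 2 ^ k) < e"
    using e by (simp add: field_simps)
  obtain b where b: "cell a l k x = hcube b (l / 2 ^ k)"
    using cell_is_hcube[OF assms(1)] .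
  have "y \<in> ball x e" if y: "y \<in> cell a l k x" for y
  proof -
    have "\<bar>(x - y) $ i\<bar> \<le> l / 2 ^ k" for i
      using y cell_refl[of x a l k] unfolding b mem_hcube by (smt (verit) vector_minus_component)
    then have "(\<Sum>i\<in>UNIV. \<bar>(x - y) $ i\<bar>) \<le> ?N * (l / 2 ^ k)"
      using sum_bounded_above[of UNIV "\<lambda>i. \<bar>(x - y) $ i\<bar>" "l / 2 ^ k"] by simp
    then show ?thesis
      using norm_le_l1_cart[of "x - y"] k by (simp add: dist_norm)
  qed
  then show ?thesis using e(2) by blast
qed

text \<open>The stopping-time selection: for each point take the first generation whose cell
  has property \<open>P\<close>. Points of one cell share all coarser cells, so they stop together and the
  chosen cells are disjoint.\<close>

lemma first_cells:
  fixes P :: "(real ^ 'n) set \<Rightarrow> bool"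
  assumes "l > 0"
  shows "\<exists>F. countable F \<and> disjoint F \<and> \<Union>F = {x \<in> hcube a l. \<exists>k. P (cell a l k x)} \<and>
    (\<forall>R\<in>F. P R \<and> (\<exists>x k. x \<in> hcube a l \<and> R = cell a l k x \<and> (\<forall>j<k. \<not> P (cell a l j x))))"
proof -
  define S where "S = {x \<in> hcube a l. \<exists>k. P (cell a l k x)}"
  define N where "N x = (LEAST k. P (cell a l k x))" for x
  define F where "F = (\<lambda>x. cell a l (N x) x) ` S"
  have P: "P (cell a l (N x) x)" if "x \<in> S" for x
    using that unfolding S_def N_def by (auto intro: LeastI)
  have nP: "\<not> P (cell a l j x)" if "j < N x" for x j
    using that not_less_Least unfolding N_def by blast
  have same: "y \<in> S \<and> cell a l (N y) y = cell a l (N x) x" if "x \<in> S" "y \<in> cell a l (N x) x" for x y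
  proof -
    have eq: "cell a l j y = cell a l j x" if "j \<le> N x" for j
      using \<open>y \<in> _\<close> cell_antimono[OF that] cell_eq by blast
    have "N y = N x"
      unfolding N_def[of y]
    proof (rule Least_equality)
      show "P (cell a l (N x) y)" using eq P that by simp
      show "N x \<le> j" if "P (cell a l j y)" for j
      proof (rule ccontr)
        assume "\<not> N x \<le> j"
        then show False using that eq[of j] nP[of j x] by simp
      qed
    qed
    moreover have "y \<in> hcube a l"
      using that cell_antimono[of 0 "N x" a l x] cell_0[OF assms, of x a] by (auto simp: S_def)
    ultimately show ?thesis
      using eq P[OF that(1)] by (auto simp: S_def intro!: exI[of _ "N x"])
  qed
  have "F \<subseteq> (\<Union>k. range (cell a l k))" by (auto simp: F_def)
  then have countable: "countable F"
    by (rule countable_subset) (intro countable_UN countable_cells countableI_type)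
  have disjoint: "disjoint F"
  proof (rule disjointI)
    fix R T assume RT: "R \<in> F" "T \<in> F" "R \<noteq> T"
    then obtain x y where xy: "x \<in> S" "R = cell a l (N x) x" "y \<in> S" "T = cell a l (N y) y"
      by (auto simp: F_def)
    have False if "z \<in> R" "z \<in> T" for z
      using same[of x z] same[of y z] that xy RT(3) by simp
    then show "R \<inter> T = {}" by blast
  qed
  have Union: "\<Union>F = {x \<in> hcube a l. \<exists>k. P (cell a l k x)}"
    unfolding S_def[symmetric]
  proof
    show "\<Union>F \<subseteq> S"
      unfolding F_def using same by blast
    show "S \<subseteq> \<Union>F"
      unfolding F_def using cell_refl by blast
  qed
  have "P R \<and> (\<exists>x k. x \<in> hcube a l \<and> R = cell a l k x \<and> (\<forall>j<k. \<not> P (cell a l j x)))"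
    if R: "R \<in> F" for R
  proof -
    obtain x where x: "x \<in> S" "R = cell a l (N x) x"
      using R by (auto simp: F_def)
    then have "x \<in> hcube a l" by (simp add: S_def)
    then show ?thesis using x P[OF x(1)] nP[of _ x] by blast
  qed
  with countable disjoint Union show ?thesis
    by (intro exI[of _ F] conjI ballI; blast)
qed

lemma nn_integral_Union_mono:
  assumes "countable F" "disjoint F" "F \<subseteq> sets M"
    and [measurable]: "u \<in> borel_measurable M" "v \<in> borel_measurable M"
    and "\<And>R. R \<in> F \<Longrightarrow> (\<integral>\<^sup>+x\<in>R. u x \<partial>M) \<le> (\<integral>\<^sup>+x\<in>R. v x \<partial>M)"
  shows "(\<integral>\<^sup>+x\<in>\<Union>F. u x \<partial>M) \<le> (\<integral>\<^sup>+x\<in>\<Union>F. v x \<partial>M)"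
proof -
  have UF: "\<Union>F \<in> sets M"
    using assms(1,3) by (intro sets.countable_Union) auto
  have *: "(\<integral>\<^sup>+x\<in>\<Union>F. w x \<partial>M) = (\<integral>\<^sup>+R. (\<integral>\<^sup>+x\<in>R. w x \<partial>M) \<partial>count_space F)"
    if [measurable]: "w \<in> borel_measurable M" for w
  proof -
    have "(\<integral>\<^sup>+x\<in>\<Union>F. w x \<partial>M) = emeasure (density M w) (\<Union>R\<in>F. R)"
      using UF by (simp add: emeasure_density)
    also have "\<dots> = (\<integral>\<^sup>+R. emeasure (density M w) R \<partial>count_space F)"
      using assms(1-3)
      by (intro emeasure_UN_countable) (auto simp: disjoint_family_on_def disjoint_def)
    also have "\<dots> = (\<integral>\<^sup>+R. (\<integral>\<^sup>+x\<in>R. w x \<partial>M) \<partial>count_space F)"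
      using assms(3) by (intro nn_integral_cong) (auto simp: emeasure_density)
    finally show ?thesis .
  qed
  show ?thesis
    unfolding *[OF assms(4)] *[OF assms(5)]
    by (rule nn_integral_mono) (use assms(6) in simp)
qed

section \<open>Young functions\<close>

lemma young_scale:
  assumes "young_function \<phi>" "0 \<le> r" "r \<le> 1" "0 \<le> t"
  shows "\<phi> (r * t) \<le> r * \<phi> t"
proof -
  have "\<phi> ((1 - r) *\<^sub>R 0 + r *\<^sub>R t) \<le> (1 - r) * \<phi> 0 + r * \<phi> t"
    using assms by (intro convex_onD[of "{0..}"]) (auto simp: young_function_def)
  then show ?thesis
    using assms(1) by (simp add: young_function_def)
qed

lemma young_nonneg: "young_function \<phi> \<Longrightarrow> 0 \<le> t \<Longrightarrow> 0 \<le> \<phi> t"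
  by (simp add: young_function_def)

lemma young_le_self: "young_function \<phi> \<Longrightarrow> 0 \<le> t \<Longrightarrow> t \<le> 1 \<Longrightarrow> \<phi> t \<le> t"
  using young_scale[of \<phi> t 1] by (simp add: young_function_def)

lemma young_mono:
  assumes "young_function \<phi>" "0 \<le> t" "t \<le> u"
  shows "\<phi> t \<le> \<phi> u"
proof (cases "u = 0")
  case False
  then have u: "0 \<le> t / u" "t / u \<le> 1" "0 \<le> u"
    using assms(2,3) by auto
  then have "\<phi> (t / u * u) \<le> t / u * \<phi> u"
    by (intro young_scale[OF assms(1)])
  also have "\<dots> \<le> 1 * \<phi> u"
    using u by (intro mult_right_mono young_nonneg[OF assms(1)])
  finally show ?thesis using False by simp
qed (use assms in auto)

lemma young_continuous:
  assumes "young_function \<phi>"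
  shows "continuous_on {0..} \<phi>"
proof -
  have "convex_on {0<..} \<phi>"
    using assms by (auto simp: young_function_def intro: convex_on_subset)
  then have "continuous_on {0<..} \<phi>"
    by (intro convex_on_continuous) auto
  then have pos: "isCont \<phi> t" if "t > 0" for t
    using that by (simp add: continuous_on_eq_continuous_at)
  have "((\<lambda>t. \<phi> t) \<longlongrightarrow> \<phi> 0) (at 0 within {0..})"
  proof (rule tendsto_sandwich[OF _ _ tendsto_const])
    have ev: "eventually (\<lambda>t::real. 0 \<le> t \<and> t \<le> 1) (at 0 within {0..})"
      unfolding eventually_at by (intro exI[of _ 1]) (auto simp: dist_real_def)
    show "eventually (\<lambda>t. \<phi> 0 \<le> \<phi> t) (at 0 within {0..})"
      using ev by eventually_elim (use assms in \<open>auto intro: young_mono\<close>)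
    show "eventually (\<lambda>t. \<phi> t \<le> t) (at 0 within {0..})"
      using ev by eventually_elim (use assms in \<open>auto intro: young_le_self\<close>)
    show "((\<lambda>t. t) \<longlongrightarrow> \<phi> 0) (at 0 within {0..})"
      using assms by (auto simp: young_function_def intro: tendsto_eq_intros)
  qed
  then show ?thesis
    unfolding continuous_on_def using pos
    by (metis atLeast_iff continuous_within isCont_def order_le_less tendsto_within_subset subset_UNIV)
qed

lemma young_comp_measurable [measurable (raw)]:
  assumes "young_function \<phi>" "r > 0" "g \<in> borel_measurable M"
  shows "(\<lambda>x. \<phi> (\<bar>g x :: real\<bar> / r)) \<in> borel_measurable M"
proof -
  have "continuous_on UNIV (\<lambda>y::real. \<phi> (\<bar>y\<bar> / r))"
    by (rule continuous_on_compose2[OF young_continuous[OF assms(1)]])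
      (use assms(2) in \<open>auto intro!: continuous_intros\<close>)
  from measurable_compose[OF assms(3) borel_measurable_continuous_onI[OF this]]
  show ?thesis .
qed

lemma quasi_submultiplicative_ge_1:
  assumes "young_function \<phi>" "quasi_submultiplicative \<phi> c"
  shows "c \<ge> 1"
proof -
  have "\<phi> (1 * 1) \<le> c * \<phi> 1 * \<phi> 1"
    using assms(2) unfolding quasi_submultiplicative_def by (metis zero_le_one)
  then show ?thesis using assms(1) by (simp add: young_function_def)
qed

text \<open>Convexity splits off the constant \<open>m\<close> with the weight under which it contributes exactly
  \<open>\<phi> 1 = 1\<close>; quasi-submultiplicativity takes the dilation \<open>s\<close> out of the remaining term.\<close>

lemma young_shift:
  assumes "young_function \<phi>" "quasi_submultiplicative \<phi> c" "m > 0" "X > 0" "s > 0" "t \<ge> 0"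
  shows "\<phi> ((m + t) / (m + X / s))
    \<le> m / (m + X / s) + (1 - m / (m + X / s)) * (c * \<phi> s * \<phi> (t / X))"
proof -
  define r where "r = m + X / s"
  have r: "r > 0" "m \<le> r" "r - m = X / s" using assms by (auto simp: r_def add_pos_pos)
  have eq: "(m + t) / r = (1 - (1 - m / r)) *\<^sub>R 1 + (1 - m / r) *\<^sub>R (s * (t / X))"
  proof -
    have "(1 - m / r) * (s * (t / X)) = (r - m) / r * (s * (t / X))"
      using r by (simp add: field_simps)
    also have "\<dots> = t / r" using r assms by simp
    finally show ?thesis using r by (simp add: add_divide_distrib)
  qed
  have "\<phi> ((m + t) / r) \<le> (1 - (1 - m / r)) * \<phi> 1 + (1 - m / r) * \<phi> (s * (t / X))"
    unfolding eq using assms r by (intro convex_onD[of "{0..}"]) (auto simp: young_function_def)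
  also have "\<phi> 1 = 1" using assms(1) by (simp add: young_function_def)
  also have "(1 - m / r) * \<phi> (s * (t / X)) \<le> (1 - m / r) * (c * \<phi> s * \<phi> (t / X))"
  proof (intro mult_left_mono)
    show "\<phi> (s * (t / X)) \<le> c * \<phi> s * \<phi> (t / X)"
      using assms unfolding quasi_submultiplicative_def by (meson divide_nonneg_pos less_imp_le)
  qed (use r in simp)
  finally show ?thesis by (simp add: r_def)
qed

section \<open>The Calderon-Zygmund decomposition\<close>

context doubling
begin

lemma cell_measurable [measurable]: "l > 0 \<Longrightarrow> cell a l k x \<in> sets borel"
  by (metis cell_is_hcube borel_hcube)

text \<open>A weak form of the differentiation theorem. Outer regularity gives an open set \<open>U\<close> around
  the exceptional set \<open>A\<close>; the first cells that lie in \<open>U\<close> and meet \<open>E\<close> cover \<open>A\<close>, and each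
  of them is the cell of a point of \<open>E\<close>, so the average of \<open>h\<close> on it is at most \<open>L\<close>.
  Shrinking \<open>U\<close> to \<open>A\<close> bounds the integral of \<open>h\<close> over \<open>A\<close> by \<open>L \<mu>(A)\<close>, although
  \<open>h > L\<close> there.\<close>

lemma AE_le_of_cell_averages:
  fixes h :: "real ^ 'n \<Rightarrow> ennreal" and L :: real
  assumes "l > 0" "L > 0" and [measurable]: "h \<in> borel_measurable borel" "E \<in> sets borel"
    and E: "E \<subseteq> hcube a l"
    and avg: "\<And>x k. x \<in> E \<Longrightarrow>
      (\<integral>\<^sup>+y\<in>cell a l k x. h y \<partial>\<mu>) \<le> ennreal L * emeasure \<mu> (cell a l k x)"
  shows "AE x in \<mu>. x \<in> E \<longrightarrow> h x \<le> ennreal L"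
proof -
  let ?Q = "hcube a l"
  define A where "A = {x \<in> E. h x > ennreal L}"
  have A_meas [measurable]: "A \<in> sets borel" unfolding A_def by measurable
  have open_bound: "(\<integral>\<^sup>+x\<in>A. h x \<partial>\<mu>) \<le> ennreal L * emeasure \<mu> (U \<inter> ?Q)"
    if U: "open U" "A \<subseteq> U" for U
  proof -
    obtain F where F: "countable F" "disjoint F"
      "\<Union>F = {x \<in> ?Q. \<exists>k. cell a l k x \<subseteq> U \<and> cell a l k x \<inter> E \<noteq> {}}"
      "\<And>R. R \<in> F \<Longrightarrow> (R \<subseteq> U \<and> R \<inter> E \<noteq> {}) \<and> (\<exists>x k. x \<in> ?Q \<and> R = cell a l k x \<and>
         (\<forall>j<k. \<not> (cell a l j x \<subseteq> U \<and> cell a l j x \<inter> E \<noteq> {})))"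
      using first_cells[OF assms(1), where P = "\<lambda>R. R \<subseteq> U \<and> R \<inter> E \<noteq> {}" and a = a]
      by (elim exE conjE) (rule that, (assumption | erule bspec)+)
    have Fm: "F \<subseteq> sets \<mu>" using F(4) cell_measurable[OF assms(1)] by fastforce
    have UFm [measurable]: "\<Union>F \<in> sets borel"
      using Fm F(1) sets.countable_Union[of F borel] by simp
    have "A \<subseteq> \<Union>F"
    proof
      fix x assume x: "x \<in> A"
      then obtain k where "cell a l k x \<subseteq> U"
        using cell_in_open[OF assms(1) U(1)] U(2) by blast
      then show "x \<in> \<Union>F"
        unfolding F(3) using x E cell_refl[of x a l k] unfolding A_def by blast
    qed
    then have "(\<integral>\<^sup>+x\<in>A. h x \<partial>\<mu>) \<le> (\<integral>\<^sup>+x\<in>\<Union>F. h x \<partial>\<mu>)"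
      by (intro nn_integral_mono) (auto simp: indicator_def)
    also have "\<dots> \<le> (\<integral>\<^sup>+x\<in>\<Union>F. ennreal L \<partial>\<mu>)"
    proof (rule nn_integral_Union_mono[OF F(1,2) Fm])
      fix R assume R: "R \<in> F"
      then obtain x k y where xk: "R = cell a l k x" "y \<in> R" "y \<in> E"
        using F(4) by blast
      then have "R = cell a l k y" using cell_eq by blast
      then show "(\<integral>\<^sup>+x\<in>R. h x \<partial>\<mu>) \<le> (\<integral>\<^sup>+x\<in>R. ennreal L \<partial>\<mu>)"
        using avg[OF xk(3), of k] assms(1) by (simp add: nn_integral_cmult_indicator)
    qed measurable
    also have "\<dots> = ennreal L * emeasure \<mu> (\<Union>F)"
      by (simp add: nn_integral_cmult_indicator)
    also have "\<dots> \<le> ennreal L * emeasure \<mu> (U \<inter> ?Q)"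
    proof (intro mult_left_mono emeasure_mono)
      show "\<Union>F \<subseteq> U \<inter> ?Q" using F(3,4) by blast
      show "U \<inter> ?Q \<in> sets \<mu>" using U by simp
    qed simp
    finally show ?thesis .
  qed
  \<comment> \<open>outer regularity applies to finite measures, so \<open>\<mu>\<close> is restricted to the cube\<close>
  define \<nu> where "\<nu> = density \<mu> (indicator ?Q)"
  have nu: "emeasure \<nu> B = emeasure \<mu> (B \<inter> ?Q)" if "B \<in> sets borel" for B
    using that by (simp add: \<nu>_def emeasure_density Int_commute nn_integral_indicator
        flip: indicator_inter_arith)
  have "emeasure \<nu> A = (INF U \<in> {U. A \<subseteq> U \<and> open U}. emeasure \<nu> U)"
  proof (rule outer_regular)
    show "sets \<nu> = sets borel" by (simp add: \<nu>_def)
    show "emeasure \<nu> (space \<nu>) \<noteq> \<infinity>"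
      using emeasure_hcube_finite[of a l] nu[of UNIV] by (simp add: \<nu>_def)
  qed measurable
  also have "\<dots> = (INF U \<in> {U. A \<subseteq> U \<and> open U}. emeasure \<mu> (U \<inter> ?Q))"
    by (intro INF_cong) (auto simp: nu)
  moreover have "A \<inter> ?Q = A" using E by (auto simp: A_def)
  ultimately have reg: "emeasure \<mu> A = (INF U \<in> {U. A \<subseteq> U \<and> open U}. emeasure \<mu> (U \<inter> ?Q))"
    using nu[OF A_meas] \<open>A \<inter> ?Q = A\<close> by simp
  have cancel: "ennreal (1 / L) * (ennreal L * z) = z" "ennreal L * (ennreal (1 / L) * z) = z" for z
    using assms(2) by (simp_all add: mult.assoc[symmetric] ennreal_mult[symmetric])
  have "ennreal (1 / L) * (\<integral>\<^sup>+x\<in>A. h x \<partial>\<mu>) \<le> emeasure \<mu> A"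
    unfolding reg
  proof (rule INF_greatest)
    fix U assume "U \<in> {U. A \<subseteq> U \<and> open U}"
    then have "ennreal (1 / L) * (\<integral>\<^sup>+x\<in>A. h x \<partial>\<mu>) \<le> ennreal (1 / L) * (ennreal L * emeasure \<mu> (U \<inter> ?Q))"
      by (intro mult_left_mono open_bound) auto
    then show "ennreal (1 / L) * (\<integral>\<^sup>+x\<in>A. h x \<partial>\<mu>) \<le> emeasure \<mu> (U \<inter> ?Q)"
      by (simp only: cancel)
  qed
  then have "ennreal L * (ennreal (1 / L) * (\<integral>\<^sup>+x\<in>A. h x \<partial>\<mu>)) \<le> ennreal L * emeasure \<mu> A"
    by (rule mult_left_mono) simp
  then have le: "(\<integral>\<^sup>+x\<in>A. h x \<partial>\<mu>) \<le> (\<integral>\<^sup>+x\<in>A. ennreal L \<partial>\<mu>)"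
    by (simp add: nn_integral_cmult_indicator cancel)
  have fin: "emeasure \<mu> A < \<infinity>"
    using E emeasure_hcube_finite[of a l] emeasure_mono[of A ?Q \<mu>]
    by (auto simp: A_def intro: le_less_trans)
  have "AE x in \<mu>. h x * indicator A x \<le> ennreal L * indicator A x"
  proof (rule ccontr)
    assume "\<not> ?thesis"
    moreover have "(\<integral>\<^sup>+x\<in>A. ennreal L \<partial>\<mu>) \<noteq> \<infinity>"
      using fin by (simp add: nn_integral_cmult_indicator ennreal_mult_eq_top_iff)
    moreover have "AE x in \<mu>. ennreal L * indicator A x \<le> h x * indicator A x"
      by (intro AE_I2) (auto simp: A_def indicator_def less_imp_le)
    ultimately have "(\<integral>\<^sup>+x\<in>A. ennreal L \<partial>\<mu>) < (\<integral>\<^sup>+x\<in>A. h x \<partial>\<mu>)"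
      by (intro nn_integral_less) auto
    with le show False by simp
  qed
  then show ?thesis
  proof eventually_elim
    case (elim x)
    show ?case
    proof
      assume "x \<in> E"
      then show "h x \<le> ennreal L"
        using elim by (cases "x \<in> A") (auto simp: A_def not_less)
    qed
  qed
qed

text \<open>The selected cubes are the first dyadic cells on which the average of \<open>h\<close> exceeds \<open>L\<close>. The
  hypothesis says that the top cube is not selected, so each selected cube has a dyadic parent; its
  average is at most \<open>L\<close>, and doubling transfers this to the selected cube. A point outside all
  selected cubes has only cells with average at most \<open>L\<close>.\<close>

lemma calderon_zygmund:
  fixes h :: "real ^ 'n \<Rightarrow> ennreal" and L :: real
  assumes "l > 0" "L > 0" and h [measurable]: "h \<in> borel_measurable borel"
    and top: "(\<integral>\<^sup>+x\<in>hcube a l. h x \<partial>\<mu>) \<le> ennreal L * emeasure \<mu> (hcube a l)"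
  shows "\<exists>F. countable F \<and> disjoint F \<and> \<Union>F \<subseteq> hcube a l \<and>
    (\<forall>R\<in>F. \<exists>b m. m > 0 \<and> R = hcube b m) \<and>
    (\<forall>R\<in>F. ennreal L * emeasure \<mu> R \<le> (\<integral>\<^sup>+x\<in>R. h x \<partial>\<mu>)) \<and>
    (\<forall>R\<in>F. (\<integral>\<^sup>+x\<in>R. h x \<partial>\<mu>) \<le> ennreal (c\<^sub>\<mu> * 2 powr n\<^sub>\<mu> * L) * emeasure \<mu> R) \<and>
    (AE x in \<mu>. x \<in> hcube a l - \<Union>F \<longrightarrow> h x \<le> ennreal L)"
proof -
  let ?Q = "hcube a l"
  define P where "P R \<longleftrightarrow> ennreal L * emeasure \<mu> R < (\<integral>\<^sup>+x\<in>R. h x \<partial>\<mu>)" for R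
  obtain F where F: "countable F" "disjoint F" "\<Union>F = {x \<in> ?Q. \<exists>k. P (cell a l k x)}"
    "\<And>R. R \<in> F \<Longrightarrow> P R \<and> (\<exists>x k. x \<in> ?Q \<and> R = cell a l k x \<and> (\<forall>j<k. \<not> P (cell a l j x)))"
    using first_cells[OF assms(1), where P = P and a = a]
    by (elim exE conjE) (rule that, (assumption | erule bspec)+)
  have cubes: "\<exists>b m. m > 0 \<and> R = hcube b m" if R: "R \<in> F" for R
  proof -
    obtain x k where "R = cell a l k x" using F(4)[OF R] by blast
    with cell_is_hcube[OF assms(1), of a k x] assms(1) show ?thesis
      by (metis divide_pos_pos zero_less_numeral zero_less_power)
  qed
  have lower: "ennreal L * emeasure \<mu> R \<le> (\<integral>\<^sup>+x\<in>R. h x \<partial>\<mu>)" if "R \<in> F" for R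
    using F(4)[OF that] by (simp add: P_def less_imp_le)
  have upper: "(\<integral>\<^sup>+x\<in>R. h x \<partial>\<mu>) \<le> ennreal (c\<^sub>\<mu> * 2 powr n\<^sub>\<mu> * L) * emeasure \<mu> R" if R: "R \<in> F" for R
  proof -
    obtain x k where x: "x \<in> ?Q" "R = cell a l k x" "\<And>j. j < k \<Longrightarrow> \<not> P (cell a l j x)" "P R"
      using F(4)[OF R] by blast
    have "\<not> P (cell a l 0 x)"
      using top unfolding P_def cell_0[OF assms(1) x(1)] by (simp add: not_less)
    then obtain j where j: "k = Suc j"
      using x(2,4) by (cases k) auto
    obtain b where b: "cell a l j x = hcube b (l / 2 ^ j)"
      using cell_is_hcube[OF assms(1)] .
    obtain d where d: "R = hcube d (l / 2 ^ k)"
      using cell_is_hcube[OF assms(1)] x(2) by metis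
    have two: "l / 2 ^ j = 2 * (l / 2 ^ k)" by (simp add: j)
    have sub: "R \<subseteq> cell a l j x" unfolding x(2) j by (rule cell_Suc_subset)
    have "(\<integral>\<^sup>+x\<in>R. h x \<partial>\<mu>) \<le> (\<integral>\<^sup>+x\<in>cell a l j x. h x \<partial>\<mu>)"
      using sub by (intro nn_integral_mono) (auto simp: indicator_def)
    also have "\<dots> \<le> ennreal L * emeasure \<mu> (cell a l j x)"
      using x(3)[of j] by (simp add: P_def j not_less)
    also have "\<dots> \<le> ennreal L * (ennreal (c\<^sub>\<mu> * 2 powr n\<^sub>\<mu>) * emeasure \<mu> R)"
      using sub assms(1) unfolding b d two
      by (intro mult_left_mono doubling_hcube) auto
    also have "\<dots> = ennreal (c\<^sub>\<mu> * 2 powr n\<^sub>\<mu> * L) * emeasure \<mu> R"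
      using assms(2) constants by (simp add: ennreal_mult mult_ac)
    finally show ?thesis .
  qed
  have [measurable]: "\<Union>F \<in> sets borel"
    using F(1) cubes by (intro sets.countable_Union) (auto, use borel_hcube in metis)
  have ae: "AE x in \<mu>. x \<in> ?Q - \<Union>F \<longrightarrow> h x \<le> ennreal L"
  proof (rule AE_le_of_cell_averages[OF assms(1,2)])
    show "(\<integral>\<^sup>+y\<in>cell a l k x. h y \<partial>\<mu>) \<le> ennreal L * emeasure \<mu> (cell a l k x)"
      if "x \<in> ?Q - \<Union>F" for x k
      using that unfolding F(3) by (auto simp: P_def not_less)
  qed (use h in auto)
  have "\<Union>F \<subseteq> ?Q" using F(3) by blast
  then show ?thesis
    using F(1,2) cubes lower upper ae by (intro exI[of _ F] conjI; blast)
qed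

end

section \<open>Oscillations\<close>

text \<open>For \<open>\<psi>(t) = t\<close> this is the mean oscillation times \<open>\<mu>(A)\<close>; for \<open>\<psi>(t) = \<phi>(t / r)\<close> the bound
  \<open>\<mu>(A)\<close> says that \<open>r\<close> is admissible in the Orlicz average of the deviation.\<close>

definition oscillation ::
  "(real ^ 'n) measure \<Rightarrow> (real \<Rightarrow> real) \<Rightarrow> (real ^ 'n \<Rightarrow> real) \<Rightarrow> (real ^ 'n) set \<Rightarrow> ennreal" where
  "oscillation \<mu> \<psi> g A = (\<integral>\<^sup>+x\<in>A. ennreal (\<psi> \<bar>g x - average \<mu> A g\<bar>) \<partial>\<mu>)"

lemma set_integrable_const:
  fixes k :: real
  assumes "A \<in> sets M" "emeasure M A < \<infinity>"
  shows "set_integrable M A (\<lambda>_. k)" "(LINT x:A|M. k) = k * measure M A"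
  using assms by (simp_all add: set_integrable_def set_lebesgue_integral_def)

lemma set_nn_integral_eq_set_integral:
  assumes "set_integrable M A u" "\<And>x. 0 \<le> u x"
  shows "(\<integral>\<^sup>+x\<in>A. ennreal (u x) \<partial>M) = ennreal (LINT x:A|M. u x)"
proof -
  have "(\<integral>\<^sup>+x\<in>A. ennreal (u x) \<partial>M) = (\<integral>\<^sup>+x. ennreal (indicator A x *\<^sub>R u x) \<partial>M)"
    by (intro nn_integral_cong) (simp add: indicator_def)
  also have "\<dots> = ennreal (LINT x:A|M. u x)"
    using assms unfolding set_integrable_def set_lebesgue_integral_def
    by (intro nn_integral_eq_integral) auto
  finally show ?thesis .
qed

locale averaging_set =
  fixes \<mu> :: "(real ^ 'n) measure" and A
  assumes A_sets: "A \<in> sets \<mu>" and A_finite: "emeasure \<mu> A < \<infinity>" and A_pos: "measure \<mu> A > 0"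
begin

lemma integrable_deviation:
  assumes "set_integrable \<mu> A g"
  shows "set_integrable \<mu> A (\<lambda>x. g x - k)" "(LINT x:A|\<mu>. g x - k) = (average \<mu> A g - k) * measure \<mu> A"
  using set_integral_diff[OF assms set_integrable_const(1)[OF A_sets A_finite]]
    set_integrable_const(2)[OF A_sets A_finite] A_pos
  by (simp_all add: average_def left_diff_distrib)

lemma average_deviation_le:
  assumes g: "set_integrable \<mu> A g" and "0 \<le> C"
    and le: "(\<integral>\<^sup>+x\<in>A. ennreal \<bar>g x - k\<bar> \<partial>\<mu>) \<le> ennreal C * emeasure \<mu> A"
  shows "\<bar>average \<mu> A g - k\<bar> \<le> C"
proof -
  note dev = integrable_deviation[OF g, of k]
  have "ennreal (LINT x:A|\<mu>. \<bar>g x - k\<bar>) \<le> ennreal (C * measure \<mu> A)"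
    using le set_nn_integral_eq_set_integral[OF set_integrable_abs[OF dev(1)]] A_finite \<open>0 \<le> C\<close>
    by (simp add: emeasure_eq_ennreal_measure ennreal_mult)
  then have "(LINT x:A|\<mu>. \<bar>g x - k\<bar>) \<le> C * measure \<mu> A"
    using \<open>0 \<le> C\<close> by (simp add: ennreal_le_iff)
  moreover have "\<bar>LINT x:A|\<mu>. g x - k\<bar> \<le> (LINT x:A|\<mu>. \<bar>g x - k\<bar>)"
  proof -
    have "\<bar>LINT x:A|\<mu>. g x - k\<bar> \<le> (LINT x|\<mu>. \<bar>indicator A x *\<^sub>R (g x - k)\<bar>)"
      unfolding set_lebesgue_integral_def by (rule integral_abs_bound)
    also have "\<dots> = (LINT x:A|\<mu>. \<bar>g x - k\<bar>)"
      unfolding set_lebesgue_integral_def by (simp add: abs_mult)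
    finally show ?thesis .
  qed
  moreover have "\<bar>LINT x:A|\<mu>. g x - k\<bar> = \<bar>average \<mu> A g - k\<bar> * measure \<mu> A"
    using dev(2) A_pos by (simp add: abs_mult)
  ultimately have "\<bar>average \<mu> A g - k\<bar> * measure \<mu> A \<le> C * measure \<mu> A"
    by linarith
  then show ?thesis by (rule mult_right_le_imp_le[OF _ A_pos])
qed

text \<open>The positive and the negative part of \<open>g - g\<^sub>A\<close> have the same integral, so each of them
  carries half of the oscillation.\<close>

lemma mean_oscillation_eq:
  assumes g: "set_integrable \<mu> A g"
  shows "set_integrable \<mu> A (\<lambda>x. max 0 (g x - average \<mu> A g))"
    "set_integrable \<mu> A (\<lambda>x. max 0 (average \<mu> A g - g x))"
    "oscillation \<mu> (\<lambda>t. t) g A = ennreal (2 * (LINT x:A|\<mu>. max 0 (g x - average \<mu> A g)))"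
    "oscillation \<mu> (\<lambda>t. t) g A = ennreal (2 * (LINT x:A|\<mu>. max 0 (average \<mu> A g - g x)))"
proof -
  let ?u = "\<lambda>x. g x - average \<mu> A g"
  have u: "set_integrable \<mu> A ?u" "(LINT x:A|\<mu>. ?u x) = 0"
    using integrable_deviation[OF g, of "average \<mu> A g"] by simp_all
  have au: "set_integrable \<mu> A (\<lambda>x. \<bar>?u x\<bar>)"
    by (rule set_integrable_abs[OF u(1)])
  have eq: "(\<lambda>x. max 0 (?u x)) = (\<lambda>x. (\<bar>?u x\<bar> + ?u x) / 2)"
    "(\<lambda>x. max 0 (average \<mu> A g - g x)) = (\<lambda>x. (\<bar>?u x\<bar> - ?u x) / 2)"
    by (auto simp: fun_eq_iff max_def)
  show "set_integrable \<mu> A (\<lambda>x. max 0 (?u x))" "set_integrable \<mu> A (\<lambda>x. max 0 (average \<mu> A g - g x))"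
    unfolding eq using au u(1)
    by (auto intro!: set_integrable_divide set_integral_add(1) set_integral_diff(1))
  have osc: "oscillation \<mu> (\<lambda>t. t) g A = ennreal (LINT x:A|\<mu>. \<bar>?u x\<bar>)"
    unfolding oscillation_def by (rule set_nn_integral_eq_set_integral[OF au]) simp
  show "oscillation \<mu> (\<lambda>t. t) g A = ennreal (2 * (LINT x:A|\<mu>. max 0 (?u x)))"
    "oscillation \<mu> (\<lambda>t. t) g A = ennreal (2 * (LINT x:A|\<mu>. max 0 (average \<mu> A g - g x)))"
    unfolding eq osc using set_integral_add(2)[OF au u(1)] set_integral_diff(2)[OF au u(1)] u(2)
    by simp_all
qed

text \<open>Whichever way \<open>T g\<^sub>A\<close> compares to the average of \<open>T \<circ> g\<close>, one of the two one-sided parts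
  decreases pointwise, and each of them carries half of the oscillation. Comparing with an arbitrary
  constant instead of the average would lose a factor \<open>2\<close>.\<close>

lemma oscillation_contraction_le:
  assumes g: "set_integrable \<mu> A g" and Tg: "set_integrable \<mu> A (\<lambda>x. T (g x))"
    and T: "mono T" "\<And>y z. y \<le> z \<Longrightarrow> T z - T y \<le> z - y"
  shows "oscillation \<mu> (\<lambda>t. t) (\<lambda>x. T (g x)) A \<le> oscillation \<mu> (\<lambda>t. t) g A"
proof (cases "T (average \<mu> A g) \<le> average \<mu> A (\<lambda>x. T (g x))")
  case True
  have "max 0 (T y - average \<mu> A (\<lambda>x. T (g x))) \<le> max 0 (y - average \<mu> A g)" for y
    using True monoD[OF T(1), of y "average \<mu> A g"] T(2)[of "average \<mu> A g" y] by linarith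
  then show ?thesis
    unfolding mean_oscillation_eq(3)[OF g] mean_oscillation_eq(3)[OF Tg]
    by (intro ennreal_leI mult_left_mono set_integral_mono mean_oscillation_eq(1) g Tg) auto
next
  case False
  have "max 0 (average \<mu> A (\<lambda>x. T (g x)) - T y) \<le> max 0 (average \<mu> A g - y)" for y
    using False monoD[OF T(1), of "average \<mu> A g" y] T(2)[of y "average \<mu> A g"] by linarith
  then show ?thesis
    unfolding mean_oscillation_eq(4)[OF g] mean_oscillation_eq(4)[OF Tg]
    by (intro ennreal_leI mult_left_mono set_integral_mono mean_oscillation_eq(2) g Tg) auto
qed

text \<open>The averages converge by dominated convergence, so the integrands converge pointwise, and
  Fatou's lemma does the rest.\<close>

lemma oscillation_limit:
  fixes g :: "nat \<Rightarrow> real ^ 'n \<Rightarrow> real" and b :: real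
  assumes \<psi>: "continuous_on {0..} \<psi>" "\<And>t. 0 \<le> t \<Longrightarrow> 0 \<le> \<psi> t" and "b \<ge> 0"
    and C: "\<And>k. C k \<in> sets \<mu>" "\<And>k. C k \<subseteq> K"
      "\<And>x. (\<lambda>k. indicator (C k) x :: real) \<longlonglongrightarrow> indicator A x"
    and K: "K \<in> sets \<mu>" "emeasure \<mu> K < \<infinity>" "set_integrable \<mu> K G"
    and g [measurable]: "\<And>k. g k \<in> borel_measurable \<mu>" and f [measurable]: "f \<in> borel_measurable \<mu>"
    and dom: "\<And>k x. \<bar>g k x\<bar> \<le> \<bar>G x\<bar>" and lim: "\<And>x. (\<lambda>k. g k x) \<longlonglongrightarrow> f x"
    and bound: "\<And>k. oscillation \<mu> \<psi> (g k) (C k) \<le> ennreal b * emeasure \<mu> (C k)"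
  shows "oscillation \<mu> \<psi> f A \<le> ennreal b * emeasure \<mu> A"
proof -
  note [measurable] = C(1) A_sets
  have Cfin: "emeasure \<mu> (C k) < \<infinity>" for k
    using emeasure_mono[OF C(2) K(1)] K(2) by (rule le_less_trans)
  have ind: "\<bar>indicator (C k) x\<bar> \<le> (indicator K x :: real)" for k x
    using C(2)[of k] by (auto simp: indicator_def)
  have meas: "(\<lambda>k. measure \<mu> (C k)) \<longlonglongrightarrow> measure \<mu> A"
  proof -
    have "(\<lambda>k. LINT x|\<mu>. indicator (C k) x) \<longlonglongrightarrow> (LINT x|\<mu>. indicator A x :: real)"
      by (rule integral_dominated_convergence[where w = "indicator K"])
        (use K ind C(3) in \<open>auto simp: integrable_indicator_iff\<close>)
    then show ?thesis
      using C(1)[THEN sets.sets_into_space] A_sets[THEN sets.sets_into_space]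
      by (simp add: Int_absorb2)
  qed
  have "(\<lambda>k. LINT x:C k|\<mu>. g k x) \<longlonglongrightarrow> (LINT x:A|\<mu>. f x)"
    unfolding set_lebesgue_integral_def
  proof (rule integral_dominated_convergence[where w = "\<lambda>x. \<bar>indicator K x *\<^sub>R G x\<bar>"])
    show "integrable \<mu> (\<lambda>x. \<bar>indicator K x *\<^sub>R G x\<bar>)"
      using K(3) unfolding set_integrable_def by (rule integrable_abs)
    show "AE x in \<mu>. (\<lambda>k. indicator (C k) x *\<^sub>R g k x) \<longlonglongrightarrow> indicator A x *\<^sub>R f x"
      by (intro AE_I2 tendsto_scaleR C(3) lim)
    show "AE x in \<mu>. norm (indicator (C k) x *\<^sub>R g k x) \<le> \<bar>indicator K x *\<^sub>R G x\<bar>" for k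
      using mult_mono[OF ind dom] by (intro AE_I2) (simp add: abs_mult)
  qed measurable
  from tendsto_divide[OF this meas] have avg: "(\<lambda>k. average \<mu> (C k) (g k)) \<longlonglongrightarrow> average \<mu> A f"
    using A_pos by (simp add: average_def)
  have mpsi: "(\<lambda>x. \<psi> \<bar>w x\<bar>) \<in> borel_measurable \<mu>" if "w \<in> borel_measurable \<mu>" for w :: "real ^ 'n \<Rightarrow> real"
  proof -
    have "continuous_on UNIV (\<lambda>y::real. \<psi> \<bar>y\<bar>)"
      by (rule continuous_on_compose2[OF \<psi>(1)]) (auto intro!: continuous_intros)
    from measurable_compose[OF that borel_measurable_continuous_onI[OF this]] show ?thesis .
  qed
  define u where "u k x = ennreal (\<psi> \<bar>g k x - average \<mu> (C k) (g k)\<bar>) * indicator (C k) x" for k x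
  have u_meas [measurable]: "u k \<in> borel_measurable \<mu>" for k
    unfolding u_def[abs_def]
    by (intro borel_measurable_times_ennreal measurable_compose[OF _ measurable_ennreal] mpsi) measurable
  have pt: "(\<lambda>k. u k x) \<longlonglongrightarrow> ennreal (\<psi> \<bar>f x - average \<mu> A f\<bar>) * indicator A x" for x
  proof -
    have "(\<lambda>k. \<psi> \<bar>g k x - average \<mu> (C k) (g k)\<bar>) \<longlonglongrightarrow> \<psi> \<bar>f x - average \<mu> A f\<bar>"
      by (rule continuous_on_tendsto_compose[OF \<psi>(1)])
        (auto intro!: tendsto_intros lim avg)
    from tendsto_ennrealI[OF tendsto_mult[OF this C(3)[of x]]]
    show ?thesis by (simp add: u_def ennreal_mult'' ennreal_indicator)
  qed
  have "oscillation \<mu> \<psi> f A = (\<integral>\<^sup>+x. liminf (\<lambda>k. u k x) \<partial>\<mu>)"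
    unfolding oscillation_def using lim_imp_Liminf[OF _ pt] by simp
  also have "\<dots> \<le> liminf (\<lambda>k. \<integral>\<^sup>+x. u k x \<partial>\<mu>)"
    by (rule nn_integral_liminf) measurable
  also have "\<dots> \<le> liminf (\<lambda>k. ennreal (b * measure \<mu> (C k)))"
  proof (intro Liminf_mono always_eventually allI)
    fix k
    show "(\<integral>\<^sup>+x. u k x \<partial>\<mu>) \<le> ennreal (b * measure \<mu> (C k))"
      using bound[of k] Cfin[of k] \<open>b \<ge> 0\<close>
      by (simp add: oscillation_def u_def emeasure_eq_ennreal_measure ennreal_mult)
  qed
  also have "\<dots> = ennreal (b * measure \<mu> A)"
    by (intro lim_imp_Liminf tendsto_ennrealI tendsto_mult tendsto_const meas) simp
  also have "\<dots> = ennreal b * emeasure \<mu> A"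
    using A_finite \<open>b \<ge> 0\<close> by (simp add: emeasure_eq_ennreal_measure ennreal_mult)
  finally show ?thesis .
qed

end

section \<open>Self-improvement of Orlicz bounds\<close>

context doubling
begin

lemma hcube_averaging: "l > 0 \<Longrightarrow> averaging_set \<mu> (hcube a l)"
  using emeasure_hcube_finite[of a l] by unfold_locales (auto simp: measure_hcube_pos)

text \<open>The self-improvement step. On a selected cube \<open>R\<close> the function splits as the deviation from
  its own average, controlled by \<open>X\<close>, plus the jump \<open>g\<^sub>R - g\<^sub>Q\<close>, controlled by \<open>D L b\<close>. The
  selected cubes fill at most the fraction \<open>1 / L\<close> of \<open>Q\<close>, and \<open>L = c \<phi>(s)\<close> is the level
  at which this gain pays for replacing \<open>X\<close> by \<open>X / s\<close>.\<close>

lemma oscillation_step: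
  fixes g :: "real ^ 'n \<Rightarrow> real"
  assumes \<phi>: "young_function \<phi>" "quasi_submultiplicative \<phi> c"
    and "s > 1" "b > 0" "X > 0" "l > 0"
    and g [measurable]: "g \<in> borel_measurable borel" and int: "\<And>a l. set_integrable \<mu> (hcube a l) g"
    and bmo: "\<And>a l. l > 0 \<Longrightarrow>
      oscillation \<mu> (\<lambda>t. t) g (hcube a l) \<le> ennreal b * emeasure \<mu> (hcube a l)"
    and orl: "\<And>a l. l > 0 \<Longrightarrow>
      oscillation \<mu> (\<lambda>t. \<phi> (t / X)) g (hcube a l) \<le> emeasure \<mu> (hcube a l)"
  shows "oscillation \<mu> (\<lambda>t. \<phi> (t / (c\<^sub>\<mu> * 2 powr n\<^sub>\<mu> * (c * \<phi> s * b) + X / s))) g (hcube a l)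
    \<le> emeasure \<mu> (hcube a l)"
proof -
  let ?Q = "hcube a l"
  define L where "L = c * \<phi> s"
  define m where "m = c\<^sub>\<mu> * 2 powr n\<^sub>\<mu> * (L * b)"
  define r where "r = m + X / s"
  \<comment> \<open>the weight of the constant \<open>m\<close> when \<open>m + t\<close> is split at scale \<open>r\<close>\<close>
  define \<theta> where "\<theta> = m / r"
  define q where "q = average \<mu> ?Q g"
  define h where "h x = ennreal \<bar>g x - q\<bar>" for x
  define \<Phi> where "\<Phi> x = ennreal (\<phi> (\<bar>g x - q\<bar> / r))" for x
  have "L \<ge> 1 * s"
    unfolding L_def using quasi_submultiplicative_ge_1[OF \<phi>] young_function_ge[OF \<phi>(1) \<open>s > 1\<close>] \<open>s > 1\<close>
    by (intro mult_mono) auto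
  then have L: "L > 1" using \<open>s > 1\<close> by simp
  then have Lb: "L * b > 0" using \<open>b > 0\<close> by simp
  have "1 * 1 \<le> c\<^sub>\<mu> * 2 powr n\<^sub>\<mu>"
    using constants by (intro mult_mono) (auto intro: ge_one_powr_ge_zero)
  then have m: "L * b \<le> m" "m > 0"
    using L \<open>b > 0\<close> mult_right_mono[of 1 "c\<^sub>\<mu> * 2 powr n\<^sub>\<mu>" "L * b"] by (auto simp: m_def)
  have r: "r > 0" "m < r" using m \<open>X > 0\<close> \<open>s > 1\<close> by (auto simp: r_def add_pos_pos)
  then have \<theta>: "0 < \<theta>" "\<theta> < 1" using m by (auto simp: \<theta>_def)
  have h_meas [measurable]: "h \<in> borel_measurable borel" unfolding h_def[abs_def] by measurable
  have \<Phi>_meas [measurable]: "\<Phi> \<in> borel_measurable borel"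
    unfolding \<Phi>_def[abs_def] using \<phi>(1) r(1) by measurable
  have h_Q: "(\<integral>\<^sup>+x\<in>?Q. h x \<partial>\<mu>) \<le> ennreal b * emeasure \<mu> ?Q"
    using bmo[OF \<open>l > 0\<close>, of a] by (simp add: oscillation_def h_def q_def)
  also have "\<dots> \<le> ennreal (L * b) * emeasure \<mu> ?Q"
    using L \<open>b > 0\<close> by (intro mult_right_mono ennreal_leI) auto
  finally have top: "(\<integral>\<^sup>+x\<in>?Q. h x \<partial>\<mu>) \<le> ennreal (L * b) * emeasure \<mu> ?Q" .
  obtain F where F: "countable F" "disjoint F" "\<Union>F \<subseteq> ?Q"
    "\<And>R. R \<in> F \<Longrightarrow> \<exists>b m. m > 0 \<and> R = hcube b m"
    "\<And>R. R \<in> F \<Longrightarrow> ennreal (L * b) * emeasure \<mu> R \<le> (\<integral>\<^sup>+x\<in>R. h x \<partial>\<mu>)"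
    "\<And>R. R \<in> F \<Longrightarrow> (\<integral>\<^sup>+x\<in>R. h x \<partial>\<mu>) \<le> ennreal m * emeasure \<mu> R"
    "AE x in \<mu>. x \<in> ?Q - \<Union>F \<longrightarrow> h x \<le> ennreal (L * b)"
    using calderon_zygmund[OF \<open>l > 0\<close> Lb h_meas top, folded m_def]
    by (elim exE conjE) (rule that, (assumption | erule bspec)+)
  define S where "S = \<Union>F"
  have F_sets: "F \<subseteq> sets \<mu>" using F(4) borel_hcube by fastforce
  then have S_sets [measurable]: "S \<in> sets borel"
    using F(1) sets.countable_Union[of F borel] by (simp add: S_def)
  have S_sub: "S \<subseteq> ?Q" using F(3) by (simp add: S_def)
  have S_fin: "emeasure \<mu> S < \<infinity>"
    using emeasure_mono[OF S_sub, of \<mu>] emeasure_hcube_finite[of a l] by (auto intro: le_less_trans)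
  define M where "M = measure \<mu> ?Q"
  define N where "N = measure \<mu> S"
  have M: "emeasure \<mu> ?Q = ennreal M" by (simp add: M_def emeasure_hcube_eq)
  have N: "emeasure \<mu> S = ennreal N"
    using S_fin by (simp add: N_def emeasure_eq_ennreal_measure)
  have D: "emeasure \<mu> (?Q - S) = ennreal (M - N)"
    using emeasure_Diff[of \<mu> S ?Q] S_fin S_sub by (simp add: M N ennreal_minus N_def)
  have "ennreal (L * b) * emeasure \<mu> S = (\<integral>\<^sup>+x\<in>\<Union>F. ennreal (L * b) \<partial>\<mu>)"
    by (simp add: nn_integral_cmult_indicator flip: S_def)
  also have "\<dots> \<le> (\<integral>\<^sup>+x\<in>\<Union>F. h x \<partial>\<mu>)"
    using F(5) F_sets
    by (intro nn_integral_Union_mono F(1,2)) (auto simp: nn_integral_cmult_indicator)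
  also have "\<dots> \<le> (\<integral>\<^sup>+x\<in>?Q. h x \<partial>\<mu>)"
    using F(3) by (intro nn_integral_mono) (auto simp: indicator_def)
  also note h_Q
  finally have "L * b * N \<le> b * M"
    using L \<open>b > 0\<close> by (simp add: M N M_def N_def flip: ennreal_mult)
  then have size: "L * N \<le> M" using \<open>b > 0\<close> by (simp add: mult_ac)
  have "(\<integral>\<^sup>+x\<in>?Q - S. \<Phi> x \<partial>\<mu>) \<le> (\<integral>\<^sup>+x\<in>?Q - S. ennreal \<theta> \<partial>\<mu>)"
  proof (rule nn_integral_mono_AE)
    show "AE x in \<mu>. \<Phi> x * indicator (?Q - S) x \<le> ennreal \<theta> * indicator (?Q - S) x"
      using F(7)
    proof eventually_elim
      case (elim x)
      show ?case
      proof (cases "x \<in> ?Q - S")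
        case True
        then have "\<bar>g x - q\<bar> \<le> m"
          using elim m(1) L \<open>b > 0\<close> by (auto simp: S_def h_def ennreal_le_iff)
        then have "\<bar>g x - q\<bar> / r \<le> \<theta>"
          using r by (simp add: \<theta>_def divide_right_mono)
        moreover have "\<phi> (\<bar>g x - q\<bar> / r) \<le> \<bar>g x - q\<bar> / r"
          using \<open>\<bar>g x - q\<bar> / r \<le> \<theta>\<close> \<theta>(2) r(1)
          by (intro young_le_self[OF \<phi>(1)] divide_nonneg_pos) linarith+
        ultimately show ?thesis
          using True by (simp add: \<Phi>_def ennreal_leI)
      qed simp
    qed
  qed
  also have "\<dots> = ennreal (\<theta> * (M - N))"
    using \<theta> by (simp add: nn_integral_cmult_indicator D ennreal_mult')
  finally have outside: "(\<integral>\<^sup>+x\<in>?Q - S. \<Phi> x \<partial>\<mu>) \<le> ennreal (\<theta> * (M - N))" .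
  have "(\<integral>\<^sup>+x\<in>\<Union>F. \<Phi> x \<partial>\<mu>) \<le> (\<integral>\<^sup>+x\<in>\<Union>F. ennreal (\<theta> + (1 - \<theta>) * L) \<partial>\<mu>)"
  proof (rule nn_integral_Union_mono[OF F(1,2) F_sets])
    fix R assume R: "R \<in> F"
    then obtain d w where dw: "w > 0" "R = hcube d w" using F(4) by blast
    interpret R: averaging_set \<mu> R using hcube_averaging dw by simp
    define p where "p = average \<mu> R g"
    have jump: "\<bar>p - q\<bar> \<le> m"
      unfolding p_def using F(6)[OF R] m int[of d w] dw
      by (intro R.average_deviation_le) (auto simp: h_def)
    have pt: "\<Phi> x \<le> ennreal \<theta> + ennreal ((1 - \<theta>) * L) * ennreal (\<phi> (\<bar>g x - p\<bar> / X))" for x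
    proof -
      have "\<phi> (\<bar>g x - q\<bar> / r) \<le> \<phi> ((m + \<bar>g x - p\<bar>) / r)"
        using jump r by (intro young_mono[OF \<phi>(1)] divide_right_mono) auto
      also have "\<dots> \<le> \<theta> + (1 - \<theta>) * (c * \<phi> s * \<phi> (\<bar>g x - p\<bar> / X))"
        unfolding \<theta>_def r_def using m \<open>X > 0\<close> \<open>s > 1\<close> by (intro young_shift \<phi>) auto
      also have "\<dots> = \<theta> + (1 - \<theta>) * L * \<phi> (\<bar>g x - p\<bar> / X)" by (simp add: L_def)
      finally show ?thesis
        using \<theta> L young_nonneg[OF \<phi>(1), of "\<bar>g x - p\<bar> / X"] \<open>X > 0\<close>
        by (simp add: \<Phi>_def flip: ennreal_mult ennreal_plus)
    qed
    have [measurable]: "R \<in> sets borel" "(\<lambda>x. \<phi> (\<bar>g x - p\<bar> / X)) \<in> borel_measurable borel"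
      using dw \<phi>(1) \<open>X > 0\<close> by (auto intro!: young_comp_measurable)
    have "(\<integral>\<^sup>+x\<in>R. \<Phi> x \<partial>\<mu>)
      \<le> (\<integral>\<^sup>+x. ennreal \<theta> * indicator R x
            + ennreal ((1 - \<theta>) * L) * (ennreal (\<phi> (\<bar>g x - p\<bar> / X)) * indicator R x) \<partial>\<mu>)"
      using pt by (intro nn_integral_mono) (auto simp: indicator_def)
    also have "\<dots> = ennreal \<theta> * emeasure \<mu> R
        + ennreal ((1 - \<theta>) * L) * oscillation \<mu> (\<lambda>t. \<phi> (t / X)) g R"
      by (simp add: nn_integral_add nn_integral_cmult nn_integral_cmult_indicator oscillation_def
          flip: p_def)
    also have "\<dots> \<le> ennreal \<theta> * emeasure \<mu> R + ennreal ((1 - \<theta>) * L) * emeasure \<mu> R"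
      unfolding dw(2) by (intro add_left_mono mult_left_mono orl dw(1)) auto
    also have "\<dots> = (\<integral>\<^sup>+x\<in>R. ennreal (\<theta> + (1 - \<theta>) * L) \<partial>\<mu>)"
      using \<theta> L by (subst nn_integral_cmult_indicator) (simp_all add: ennreal_plus distrib_right)
    finally show "(\<integral>\<^sup>+x\<in>R. \<Phi> x \<partial>\<mu>) \<le> (\<integral>\<^sup>+x\<in>R. ennreal (\<theta> + (1 - \<theta>) * L) \<partial>\<mu>)" .
  qed measurable
  also have "\<dots> = ennreal ((\<theta> + (1 - \<theta>) * L) * N)"
    using \<theta> L by (simp add: nn_integral_cmult_indicator N ennreal_mult' flip: S_def)
  finally have inside: "(\<integral>\<^sup>+x\<in>S. \<Phi> x \<partial>\<mu>) \<le> ennreal ((\<theta> + (1 - \<theta>) * L) * N)"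
    by (simp add: S_def)
  have "(\<integral>\<^sup>+x\<in>?Q. \<Phi> x \<partial>\<mu>) = (\<integral>\<^sup>+x. \<Phi> x * indicator (?Q - S) x + \<Phi> x * indicator S x \<partial>\<mu>)"
    using S_sub by (intro nn_integral_cong) (auto simp: indicator_def)
  also have "\<dots> = (\<integral>\<^sup>+x\<in>?Q - S. \<Phi> x \<partial>\<mu>) + (\<integral>\<^sup>+x\<in>S. \<Phi> x \<partial>\<mu>)"
    by (rule nn_integral_add) measurable
  also have "\<dots> \<le> ennreal (\<theta> * (M - N)) + ennreal ((\<theta> + (1 - \<theta>) * L) * N)"
    by (intro add_mono outside inside)
  also have "\<dots> = ennreal (\<theta> * (M - N) + (\<theta> + (1 - \<theta>) * L) * N)"
  proof (rule ennreal_plus[symmetric])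
    have "N \<le> L * N" using L mult_right_mono[of 1 L N] by (simp add: N_def)
    then show "0 \<le> \<theta> * (M - N)" using size \<theta> by simp
    show "0 \<le> (\<theta> + (1 - \<theta>) * L) * N" using \<theta> L by (simp add: N_def)
  qed
  also have "\<dots> \<le> ennreal M"
  proof (rule ennreal_leI)
    have "\<theta> * (M - N) + (\<theta> + (1 - \<theta>) * L) * N = \<theta> * M + (1 - \<theta>) * (L * N)"
      by (simp add: algebra_simps)
    also have "\<dots> \<le> \<theta> * M + (1 - \<theta>) * M"
      using size \<theta> by (intro add_left_mono mult_left_mono) auto
    finally show "\<theta> * (M - N) + (\<theta> + (1 - \<theta>) * L) * N \<le> M" by (simp add: algebra_simps)
  qed
  finally show ?thesis
    by (simp add: oscillation_def \<Phi>_def q_def M r_def m_def L_def mult_ac)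
qed

text \<open>The map \<open>X \<mapsto> K + X / s\<close> contracts to its fixed point \<open>K s / (s - 1)\<close>. The bound on \<open>g\<close>
  supplies a scale from which the iteration can start: deviations are at most \<open>2 B\<close>.\<close>

lemma oscillation_bounded:
  fixes g :: "real ^ 'n \<Rightarrow> real"
  assumes \<phi>: "young_function \<phi>" "quasi_submultiplicative \<phi> c"
    and "s > 1" "b > 0" "l > 0"
    and g [measurable]: "g \<in> borel_measurable borel" and int: "\<And>a l. set_integrable \<mu> (hcube a l) g"
    and bd: "\<And>x. \<bar>g x\<bar> \<le> B"
    and bmo: "\<And>a l. l > 0 \<Longrightarrow>
      oscillation \<mu> (\<lambda>t. t) g (hcube a l) \<le> ennreal b * emeasure \<mu> (hcube a l)"
    and r: "r > c\<^sub>\<mu> * 2 powr n\<^sub>\<mu> * (c * \<phi> s * b) * (s / (s - 1))"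
  shows "oscillation \<mu> (\<lambda>t. \<phi> (t / r)) g (hcube a l) \<le> emeasure \<mu> (hcube a l)"
proof -
  define K where "K = c\<^sub>\<mu> * 2 powr n\<^sub>\<mu> * (c * \<phi> s * b)"
  define Y where "Y = K * (s / (s - 1))"
  \<comment> \<open>starting above the fixed point keeps all iterates positive\<close>
  define X0 where "X0 = max (2 * B) Y"
  define X where "X n = Y + (X0 - Y) / s ^ n" for n
  have "c > 0" "\<phi> s > 0"
    using \<phi> young_function_ge[OF \<phi>(1) \<open>s > 1\<close>] \<open>s > 1\<close> by (auto simp: quasi_submultiplicative_def)
  then have "K > 0" using constants \<open>b > 0\<close> by (simp add: K_def)
  then have "Y > 0" using \<open>s > 1\<close> by (simp add: Y_def)
  have Y: "K + Y / s = Y" using \<open>s > 1\<close> by (simp add: Y_def field_simps)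
  have X_pos: "X n > 0" for n
    using \<open>Y > 0\<close> \<open>s > 1\<close> by (auto simp: X_def X0_def intro!: add_pos_nonneg)
  have X_Suc: "X (Suc n) = K + X n / s" for n
  proof -
    have "K + X n / s = (K + Y / s) + (X0 - Y) / s ^ Suc n"
      by (simp add: X_def add_divide_distrib mult.commute)
    then show ?thesis by (simp add: X_def Y)
  qed
  have B: "B \<ge> 0" using bd[of 0] by linarith
  have all: "oscillation \<mu> (\<lambda>t. \<phi> (t / X n)) g (hcube a l) \<le> emeasure \<mu> (hcube a l)"
    if "l > 0" for a l n
    using that
  proof (induction n arbitrary: a l)
    case 0
    interpret R: averaging_set \<mu> "hcube a l" by (rule hcube_averaging[OF 0])
    have "\<bar>average \<mu> (hcube a l) g - 0\<bar> \<le> B"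
    proof (rule R.average_deviation_le[OF int B])
      have "(\<integral>\<^sup>+x\<in>hcube a l. ennreal \<bar>g x - 0\<bar> \<partial>\<mu>) \<le> (\<integral>\<^sup>+x\<in>hcube a l. ennreal B \<partial>\<mu>)"
        using bd by (intro nn_integral_mono mult_right_mono ennreal_leI) auto
      then show "(\<integral>\<^sup>+x\<in>hcube a l. ennreal \<bar>g x - 0\<bar> \<partial>\<mu>) \<le> ennreal B * emeasure \<mu> (hcube a l)"
        by (simp add: nn_integral_cmult_indicator)
    qed
    then have le: "\<bar>g x - average \<mu> (hcube a l) g\<bar> \<le> X 0" for x
      using bd[of x] by (simp add: X_def X0_def)
    have "\<phi> (\<bar>g x - average \<mu> (hcube a l) g\<bar> / X 0) \<le> \<phi> 1" for x
      using le[of x] X_pos[of 0] by (intro young_mono[OF \<phi>(1)]) auto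
    then have "\<phi> (\<bar>g x - average \<mu> (hcube a l) g\<bar> / X 0) \<le> 1" for x
      using \<phi>(1) by (simp add: young_function_def)
    then have "oscillation \<mu> (\<lambda>t. \<phi> (t / X 0)) g (hcube a l) \<le> (\<integral>\<^sup>+x\<in>hcube a l. ennreal 1 \<partial>\<mu>)"
      unfolding oscillation_def by (intro nn_integral_mono mult_right_mono ennreal_leI) auto
    then show ?case by simp
  next
    case (Suc n)
    show ?case
      unfolding X_Suc K_def
      using Suc.IH bmo
      by (intro oscillation_step \<phi> \<open>s > 1\<close> \<open>b > 0\<close> X_pos Suc.prems g int)
  qed
  have "X \<longlonglongrightarrow> Y + 0"
    unfolding X_def using \<open>s > 1\<close> by (intro tendsto_add tendsto_const LIMSEQ_divide_realpow_zero)
  then have "eventually (\<lambda>n. X n < r) sequentially"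
    using r by (intro order_tendstoD(2)) (auto simp: Y_def K_def)
  then obtain n where n: "X n < r"
    by (meson eventually_sequentially order_refl)
  have "oscillation \<mu> (\<lambda>t. \<phi> (t / r)) g (hcube a l) \<le> oscillation \<mu> (\<lambda>t. \<phi> (t / X n)) g (hcube a l)"
    unfolding oscillation_def using n X_pos[of n]
    by (intro nn_integral_mono mult_right_mono ennreal_leI young_mono[OF \<phi>(1)] divide_left_mono) auto
  also have "\<dots> \<le> emeasure \<mu> (hcube a l)" using all[OF \<open>l > 0\<close>] .
  finally show ?thesis .
qed

end

section \<open>From half-open to closed cubes\<close>

lemma indicator_cube_tendsto_hcube:
  fixes a :: "real ^ 'n"
  assumes "l > 0"
  shows "(\<lambda>k. indicator (cube a (l * (1 - 1 / (real k + 2)))) x :: real) \<longlonglongrightarrow> indicator (hcube a l) x"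
proof (rule tendsto_eventually)
  have lim: "(\<lambda>k. a $ i + l * (1 - 1 / (real k + 2))) \<longlonglongrightarrow> a $ i + l" for i
    by real_asymp
  show "\<forall>\<^sub>F k in sequentially. indicator (cube a (l * (1 - 1 / (real k + 2)))) x = (indicator (hcube a l) x :: real)"
  proof (cases "x \<in> hcube a l")
    case True
    have "\<forall>\<^sub>F k in sequentially. x $ i < a $ i + l * (1 - 1 / (real k + 2))" for i
      using True by (intro order_tendstoD(1)[OF lim]) (simp add: mem_hcube)
    then have "\<forall>\<^sub>F k in sequentially. \<forall>i. x $ i < a $ i + l * (1 - 1 / (real k + 2))"
      by (rule eventually_all_finite)
    then show ?thesis
      by eventually_elim (use True in \<open>auto simp: indicator_def mem_cube mem_hcube less_imp_le\<close>)
  next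
    case False
    have "cube a (l * (1 - 1 / (real k + 2))) \<subseteq> hcube a l" for k
      using assms by (intro cube_subset_hcube) (simp add: field_simps)
    then show ?thesis
      using False by (intro always_eventually) (auto simp: indicator_def)
  qed
qed

lemma indicator_hcube_tendsto_cube:
  fixes a :: "real ^ 'n"
  shows "(\<lambda>k. indicator (hcube a (l + 1 / (real k + 1))) x :: real) \<longlonglongrightarrow> indicator (cube a l) x"
proof (rule tendsto_eventually)
  have lim: "(\<lambda>k. a $ i + (l + 1 / (real k + 1))) \<longlonglongrightarrow> a $ i + l" for i
    by real_asymp
  show "\<forall>\<^sub>F k in sequentially. indicator (hcube a (l + 1 / (real k + 1))) x = (indicator (cube a l) x :: real)"
  proof (cases "x \<in> cube a l")
    case True
    have "cube a l \<subseteq> hcube a (l + 1 / (real k + 1))" for k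
      by (intro cube_subset_hcube) simp
    then show ?thesis
      using True by (intro always_eventually) (auto simp: indicator_def)
  next
    case False
    then obtain i where i: "x $ i < a $ i \<or> a $ i + l < x $ i"
      by (auto simp: mem_cube not_le)
    have "\<forall>\<^sub>F k in sequentially. x $ i < a $ i \<or> a $ i + (l + 1 / (real k + 1)) < x $ i"
    proof (cases "x $ i < a $ i")
      case False
      then have "\<forall>\<^sub>F k in sequentially. a $ i + (l + 1 / (real k + 1)) < x $ i"
        using i by (intro order_tendstoD(2)[OF lim]) auto
      then show ?thesis by eventually_elim simp
    qed simp
    then show ?thesis
    proof eventually_elim
      case (elim k)
      then have "x \<notin> hcube a (l + 1 / (real k + 1))"
        unfolding mem_hcube by (metis not_less order_less_asym)
      then show ?case using False by simp
    qed
  qed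
qed

context doubling
begin

lemma cube_averaging: "l > 0 \<Longrightarrow> averaging_set \<mu> (cube a l)"
  using emeasure_compact_finite[OF compact_cube, of a l] emeasure_cube_pos[of l a]
  by unfold_locales (auto simp: emeasure_eq_ennreal_measure)

lemma locally_integrable_borel:
  assumes "locally_integrable \<mu> f"
  shows "f \<in> borel_measurable borel"
proof -
  have "(\<lambda>x. indicator (cball 0 (real k)) x *\<^sub>R f x) \<in> borel_measurable \<mu>" for k
  proof -
    have "set_integrable \<mu> (cball 0 (real k)) f"
      using assms compact_cball unfolding locally_integrable_def by blast
    then show ?thesis
      unfolding set_integrable_def by (rule borel_measurable_integrable)
  qed
  then have *: "(\<lambda>x. indicator (cball 0 (real k)) x *\<^sub>R f x) \<in> borel_measurable borel" for k
    by simp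
  show ?thesis
  proof (rule borel_measurable_LIMSEQ_metric[OF *])
    fix x :: "real ^ 'n"
    have "\<forall>\<^sub>F k in sequentially. norm x \<le> real k"
      by real_asymp
    then have "\<forall>\<^sub>F k in sequentially. indicator (cball 0 (real k)) x *\<^sub>R f x = f x"
      by eventually_elim (simp add: indicator_def)
    then show "(\<lambda>k. indicator (cball 0 (real k)) x *\<^sub>R f x) \<longlonglongrightarrow> f x"
      by (rule tendsto_eventually)
  qed
qed

text \<open>The closed cubes of side \<open>(1 - 1 / (k + 2)) l\<close> increase to the half-open cube; the \<open>2\<close> keeps
  their sides positive from \<open>k = 0\<close> on.\<close>

lemma oscillation_hcube_le:
  assumes f: "locally_integrable \<mu> f" and b: "bmo_norm \<mu> f \<le> ennreal b" "b \<ge> 0" and "l > 0"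
  shows "oscillation \<mu> (\<lambda>t. t) f (hcube a l) \<le> ennreal b * emeasure \<mu> (hcube a l)"
proof -
  interpret R: averaging_set \<mu> "hcube a l" by (rule hcube_averaging[OF \<open>l > 0\<close>])
  have closed: "oscillation \<mu> (\<lambda>t. t) f (cube a m) \<le> ennreal b * emeasure \<mu> (cube a m)" if m: "m > 0" for m
  proof -
    let ?e = "emeasure \<mu> (cube a m)"
    have "oscillation \<mu> (\<lambda>t. t) f (cube a m) / ?e \<le> bmo_norm \<mu> f"
      unfolding oscillation_def bmo_norm_def by (rule SUP_upper) (use m in blast)
    then have le: "?e * (oscillation \<mu> (\<lambda>t. t) f (cube a m) / ?e) \<le> ?e * ennreal b"
      using b by (intro mult_left_mono) auto
    have "?e \<noteq> 0" "?e \<noteq> \<infinity>"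
      using emeasure_cube_pos[OF m, of a] emeasure_compact_finite[OF compact_cube, of a m] by auto
    then have "?e * (oscillation \<mu> (\<lambda>t. t) f (cube a m) / ?e) = oscillation \<mu> (\<lambda>t. t) f (cube a m)"
      by (subst ennreal_times_divide, subst mult.commute) (auto simp: ennreal_mult_divide_eq)
    with le show ?thesis by (simp add: mult.commute)
  qed
  show ?thesis
  proof (rule R.oscillation_limit[where g = "\<lambda>_. f" and G = f and K = "cube a l"
        and C = "\<lambda>k. cube a (l * (1 - 1 / (real k + 2)))"])
    show "set_integrable \<mu> (cube a l) f"
      using f compact_cube by (auto simp: locally_integrable_def)
    show "emeasure \<mu> (cube a l) < \<infinity>"
      by (rule emeasure_compact_finite[OF compact_cube])
    show "cube a (l * (1 - 1 / (real k + 2))) \<subseteq> cube a l" for k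
      using hcube_subset_cube cube_subset_hcube[of "l * (1 - 1 / (real k + 2))" l a] \<open>l > 0\<close>
      by (fastforce simp: field_simps)
    show "oscillation \<mu> (\<lambda>t. t) f (cube a (l * (1 - 1 / (real k + 2))))
        \<le> ennreal b * emeasure \<mu> (cube a (l * (1 - 1 / (real k + 2))))" for k
      using \<open>l > 0\<close> by (intro closed) simp
  qed (use b locally_integrable_borel[OF f] indicator_cube_tendsto_hcube[OF \<open>l > 0\<close>] in \<open>auto intro: continuous_on_id\<close>)
qed

text \<open>Truncation makes the functions bounded without increasing their oscillations, and both the
  truncation and the passage from half-open to closed cubes are undone in one limit.\<close>

lemma oscillation_orlicz_le:
  assumes \<phi>: "young_function \<phi>" "quasi_submultiplicative \<phi> c"
    and "s > 1" "b > 0" "l > 0"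
    and f: "locally_integrable \<mu> f" and b: "bmo_norm \<mu> f \<le> ennreal b"
    and r: "r > c\<^sub>\<mu> * 2 powr n\<^sub>\<mu> * (c * \<phi> s * b) * (s / (s - 1))" "r > 0"
  shows "oscillation \<mu> (\<lambda>t. \<phi> (t / r)) f (cube a l) \<le> emeasure \<mu> (cube a l)"
proof -
  interpret Q: averaging_set \<mu> "cube a l" by (rule cube_averaging[OF \<open>l > 0\<close>])
  define T where "T k y = max (- real k) (min (real k) y)" for k y
  have f_meas [measurable]: "f \<in> borel_measurable borel" by (rule locally_integrable_borel[OF f])
  have T_meas [measurable]: "(\<lambda>x. T k (f x)) \<in> borel_measurable borel" for k
    unfolding T_def by measurable
  have T_le: "\<bar>T k y\<bar> \<le> \<bar>y\<bar>" "\<bar>T k y\<bar> \<le> real k" for k y by (auto simp: T_def)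
  have f_cube: "set_integrable \<mu> (cube a l) f" for a l
    using f compact_cube by (auto simp: locally_integrable_def)
  then have f_int: "set_integrable \<mu> (hcube a l) f" for a l
    by (rule set_integrable_subset[OF _ _ hcube_subset_cube]) simp
  have T_int: "set_integrable \<mu> (hcube a l) (\<lambda>x. T k (f x))" for a l k
    by (rule set_integrable_bound[OF f_int]) (auto simp: T_le set_borel_measurable_def)
  have T_bmo: "oscillation \<mu> (\<lambda>t. t) (\<lambda>x. T k (f x)) (hcube a l) \<le> ennreal b * emeasure \<mu> (hcube a l)"
    if "l > 0" for a l k
  proof -
    interpret R: averaging_set \<mu> "hcube a l" by (rule hcube_averaging[OF that])
    have "oscillation \<mu> (\<lambda>t. t) (\<lambda>x. T k (f x)) (hcube a l) \<le> oscillation \<mu> (\<lambda>t. t) f (hcube a l)"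
      by (rule R.oscillation_contraction_le[OF f_int T_int]) (auto simp: T_def mono_def)
    also have "\<dots> \<le> ennreal b * emeasure \<mu> (hcube a l)"
      using \<open>b > 0\<close> that by (intro oscillation_hcube_le f b) auto
    finally show ?thesis .
  qed
  have "oscillation \<mu> (\<lambda>t. \<phi> (t / r)) f (cube a l) \<le> ennreal 1 * emeasure \<mu> (cube a l)"
  proof (rule Q.oscillation_limit[where g = "\<lambda>k x. T k (f x)" and G = f and K = "cube a (l + 1)"
        and C = "\<lambda>k. hcube a (l + 1 / (real k + 1))"])
    show "continuous_on {0..} (\<lambda>t. \<phi> (t / r))"
      by (rule continuous_on_compose2[OF young_continuous[OF \<phi>(1)]])
        (use r in \<open>auto intro!: continuous_intros\<close>)
    show "0 \<le> \<phi> (t / r)" if "0 \<le> t" for t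
      using that r by (simp add: young_nonneg[OF \<phi>(1)])
    show "hcube a (l + 1 / (real k + 1)) \<subseteq> cube a (l + 1)" for k
    proof -
      have "1 / (real k + 1) \<le> 1" by simp
      then have "x < y + (l + 1 / (real k + 1)) \<Longrightarrow> x \<le> y + (l + 1)" for x y by linarith
      then show ?thesis unfolding subset_iff mem_hcube mem_cube by blast
    qed
    show "emeasure \<mu> (cube a (l + 1)) < \<infinity>"
      by (rule emeasure_compact_finite[OF compact_cube])
    show "(\<lambda>k. T k (f x)) \<longlonglongrightarrow> f x" for x
    proof (rule tendsto_eventually)
      have "\<forall>\<^sub>F k in sequentially. \<bar>f x\<bar> \<le> real k" by real_asymp
      then show "\<forall>\<^sub>F k in sequentially. T k (f x) = f x"
        by eventually_elim (auto simp: T_def)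
    qed
    show "oscillation \<mu> (\<lambda>t. \<phi> (t / r)) (\<lambda>x. T k (f x)) (hcube a (l + 1 / (real k + 1)))
        \<le> ennreal 1 * emeasure \<mu> (hcube a (l + 1 / (real k + 1)))" for k
    proof -
      have "l + 1 / (real k + 1) > 0" using \<open>l > 0\<close> by (intro add_pos_pos) auto
      then show ?thesis
        using oscillation_bounded[OF \<phi> \<open>s > 1\<close> \<open>b > 0\<close> _ T_meas T_int T_le(2) T_bmo r(1)] by simp
    qed
  qed (use f_cube T_le indicator_hcube_tendsto_cube in auto)
  then show ?thesis by simp
qed

end

section \<open>The Orlicz estimate\<close>

theorem corollary4p2:
  fixes \<mu> :: "(real ^ 'n) measure" and c\<^sub>\<mu> n\<^sub>\<mu> :: real
    and \<phi> :: "real \<Rightarrow> real" and c :: real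
    and f :: "real ^ 'n \<Rightarrow> real"
    and Q :: "(real ^ 'n) set" and a :: "real ^ 'n" and l :: real
  assumes "doubling_measure \<mu> c\<^sub>\<mu> n\<^sub>\<mu>"
    and "young_function \<phi>"
    and "quasi_submultiplicative \<phi> c"
    and "\<And>t. t > 1 \<Longrightarrow> \<phi> differentiable (at t)"
    and "f \<in> BMO \<mu>"
    and "l > 0" and "Q = cube a l"
  shows "orlicz_average \<phi> \<mu> Q (\<lambda>x. f x - average \<mu> Q f)
    \<le> ennreal (c\<^sub>\<mu> * 2 powr n\<^sub>\<mu> * \<phi> (c * (1 + 1 / lower_index \<phi>)) * (upper_index \<phi> + 1))
        * bmo_norm \<mu> f"
proof -
  interpret doubling \<mu> c\<^sub>\<mu> n\<^sub>\<mu> by unfold_locales (rule assms(1))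
  interpret Q: averaging_set \<mu> Q unfolding assms(7) by (rule cube_averaging[OF assms(6)])
  define p where "p = lower_index \<phi>"
  define q where "q = upper_index \<phi>"
  define s where "s = 1 + 1 / p"
  define D where "D = c\<^sub>\<mu> * 2 powr n\<^sub>\<mu>"
  define K where "K = D * \<phi> (c * s) * (q + 1)"
  have p: "p \<ge> 1" unfolding p_def by (rule lower_index_best(1)[OF assms(2,4)])
  have "p * \<phi> 2 \<le> 2 * deriv \<phi> 2"
    unfolding p_def by (rule lower_index_best(2)[OF assms(2,4)]) auto
  also have "\<dots> \<le> q * \<phi> 2"
    unfolding q_def by (rule upper_index_best(1)[OF assms(2,3,4)]) auto
  finally have pq: "p \<le> q"
    using young_function_ge[OF assms(2), of 2] by simp
  have s: "s > 1" "s / (s - 1) = p + 1" using p by (auto simp: s_def field_simps)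
  have c: "c \<ge> 1" by (rule quasi_submultiplicative_ge_1[OF assms(2,3)])
  have "\<phi> (1 / c * (c * s)) \<le> 1 / c * \<phi> (c * s)"
    using c s by (intro young_scale[OF assms(2)]) auto
  then have cs: "c * \<phi> s \<le> \<phi> (c * s)" using c by (simp add: field_simps)
  have \<phi>s: "\<phi> s \<ge> s" by (rule young_function_ge[OF assms(2) s(1)])
  have "c * \<phi> s > 0" using c s \<phi>s by simp
  moreover have D: "D > 0" using constants by (simp add: D_def)
  ultimately have K: "K > 0" using cs p pq by (simp add: K_def)
  have K_ge: "D * (c * \<phi> s * b) * (s / (s - 1)) \<le> K * b" if "b \<ge> 0" for b
  proof -
    have "D * (c * \<phi> s) * (p + 1) \<le> K"
      unfolding K_def using cs pq p D \<open>c * \<phi> s > 0\<close> by (intro mult_mono mult_left_mono) auto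
    from mult_right_mono[OF this that] show ?thesis by (simp add: s(2) mult_ac)
  qed
  have f: "locally_integrable \<mu> f" "bmo_norm \<mu> f < \<infinity>"
    using assms(5) by (auto simp: BMO_def)
  obtain B where B: "B \<ge> 0" "bmo_norm \<mu> f = ennreal B"
    using f(2) by (cases "bmo_norm \<mu> f") auto
  have le: "orlicz_average \<phi> \<mu> Q (\<lambda>x. f x - average \<mu> Q f) \<le> ennreal (K * B + e)" if e: "e > 0" for e
  proof -
    \<comment> \<open>the norm \<open>B\<close> may vanish, and the iteration needs a positive bound\<close>
    define b where "b = B + e / (2 * K)"
    have b: "b > 0" "b \<ge> 0" "B \<le> b" using B e K by (auto simp: b_def add_nonneg_pos)
    have "K * b < K * B + e" using K e by (simp add: b_def distrib_left)
    with K_ge[OF b(2)] have less: "D * (c * \<phi> s * b) * (s / (s - 1)) < K * B + e" by linarith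
    have pos: "K * B + e > 0" using B K e by (simp add: add_nonneg_pos)
    have "oscillation \<mu> (\<lambda>t. \<phi> (t / (K * B + e))) f Q \<le> emeasure \<mu> Q"
      unfolding assms(7) using b s B less pos
      by (intro oscillation_orlicz_le[OF assms(2,3) s(1) b(1) assms(6) f(1)])
        (auto simp: D_def ennreal_leI)
    then have "oscillation \<mu> (\<lambda>t. \<phi> (t / (K * B + e))) f Q / emeasure \<mu> Q \<le> emeasure \<mu> Q / emeasure \<mu> Q"
      by (rule divide_right_mono_ennreal)
    also have "\<dots> \<le> 1"
      using Q.A_pos Q.A_finite
      by (intro order_eq_refl ennreal_divide_self) (auto simp: measure_def)
    finally show ?thesis
      unfolding orlicz_average_def oscillation_def using pos by (intro Inf_lower) blast
  qed
  have "orlicz_average \<phi> \<mu> Q (\<lambda>x. f x - average \<mu> Q f) \<le> ennreal (K * B)"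
  proof (rule ennreal_le_epsilon)
    show "orlicz_average \<phi> \<mu> Q (\<lambda>x. f x - average \<mu> Q f) \<le> ennreal (K * B) + ennreal e" if "0 < e" for e
      using le[OF that] K B that by (simp add: ennreal_plus)
  qed
  also have "\<dots> = ennreal K * bmo_norm \<mu> f"
    using K B by (simp add: ennreal_mult)
  finally show ?thesis by (simp add: K_def D_def s_def p_def q_def)
qed

end
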